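(* Let $d\ge 2$. There is a number $c=c_d>0$, depending only on $d$, such that for every $r\in\mathbb{N}$ and every integer $v\in[cr^{d-1},r^d]$ there is a polytope $P\in\mathcal{P}^d(r)$ with $v(P)=v$.
   Context: $\mathbb{N}$ denotes the positive integers. Let $e_1,\ldots,e_d$ be the standard basis of $\mathbb{R}^d$. A convex lattice polytope in $\mathbb{R}^d$ is a convex polytope all of whose vertices belong to $\mathbb{Z}^d$ (it need not be full-dimensional). For $r\in\mathbb{N}$ let $A(r)=\mathrm{conv}\{re_1,\ldots,re_d\}$ and $S(r)=\mathrm{conv}(A(r)\cup\{0\})$. Let $\mathcal{P}^d(r)$ be the collection of all convex lattice polytopes $P\subset\mathbb{R}^d$ with $A(r)\subset P\subset S(r)$. For $P\in\mathcal{P}^d(r)$ put $v(P)=d!\,\mathrm{vol}(P)$, where $\mathrm{vol}$ is $d$-dimensional volume; $v(P)$ is an integer with $0\le v(P)\le r^d$. *)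

theory Defs
  imports "HOL-Analysis.Analysis"
begin

text \<open>The ambient space of dimension \<open>d\<close> is \<open>real ^ 'n\<close> with \<open>d = CARD('n)\<close>.\<close>

definition integer_lattice :: "(real ^ 'n) set" where
  "integer_lattice = {x. \<forall>i. x $ i \<in> \<int>}"

text \<open>The vertices of a polytope are its extreme points.\<close>

definition lattice_polytope :: "(real ^ 'n) set \<Rightarrow> bool" where
  "lattice_polytope P \<longleftrightarrow> polytope P \<and> {x. x extreme_point_of P} \<subseteq> integer_lattice"

definition simplex_face :: "nat \<Rightarrow> (real ^ 'n) set" where
  "simplex_face r = convex hull (range (\<lambda>i. real r *\<^sub>R axis i 1))"

definition simplex_full :: "nat \<Rightarrow> (real ^ 'n) set" where
  "simplex_full r = convex hull (simplex_face r \<union> {0})"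

definition lattice_polytopes_between :: "nat \<Rightarrow> (real ^ 'n) set set" where
  "lattice_polytopes_between r =
     {P. lattice_polytope P \<and> simplex_face r \<subseteq> P \<and> P \<subseteq> simplex_full r}"

definition normalized_volume :: "(real ^ 'n) set \<Rightarrow> real" where
  "normalized_volume P = fact CARD('n) * measure lebesgue P"

end

theory Submission
  imports Defs
begin

text \<open>
  Count what is missing.  Put \<open>u = r\<^sup>d - v(P)\<close>, the normalized volume of \<open>S(r) - P\<close>; the task is to
  realize every integer \<open>u\<close> with \<open>0 \<le> u \<le> r\<^sup>d - c r\<^bsup>d-1\<^esup>\<close>.  If \<open>P\<close> is the hull of \<open>A(r)\<close> and a finite
  set \<open>X\<close> of lattice points of \<open>S(r)\<close> that contains a point on every coordinate axis, then \<open>S(r) - P\<close>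
  is the part of the positive orthant below the Newton polyhedron of \<open>X\<close>
  (\<open>convex_hull_lattice_config\<close>).  Its normalized volume, the covolume of \<open>X\<close>, no longer depends on
  \<open>r\<close>, and a set of points that live in a coordinate subspace can be made full-dimensional by adding
  the unit vectors of the remaining axes.  This allows an induction on the number of coordinates
  in use inside one fixed ambient space.

  The induction rests on filling corners.  Take the simplex with vertices \<open>a e\<^sub>j\<close>, of
  covolume \<open>a\<^sup>k\<close>.  Near the vertex \<open>a e\<^sub>i\<close> replace the facet \<open>\<Sum>x\<^sub>j = a\<close> by a
  configuration \<open>Y\<close> written in the coordinates in which \<open>x\<^sub>i\<close> is replaced by the height
  \<open>\<Sum>x\<^sub>j - a\<close> above that facet.  This coordinate change is unimodular, so the covolume grows by exactly
  that of \<open>Y\<close>; corners at different vertices contribute independently as long as they do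
  not overlap (\<open>covolume_corners\<close>).

  Let all covolumes up to \<open>M\<^sup>k - C M\<^bsup>k-1\<^esup>\<close> be available in \<open>k\<close> coordinates and size \<open>M\<close>.
  In \<open>k + 1\<close> coordinates put \<open>a = 2 m + C\<close> and \<open>M = m + C\<close>, so that \<open>a = m + M\<close>.  One corner of size \<open>M\<close> is filled
  by a configuration of covolume \<open>w\<close> from the induction hypothesis together with a point at height 1,
  and a second corner of size \<open>m\<close> by a simplex of height \<open>h\<close>, whose covolume is \<open>h m\<^sup>k\<close>.  They
  do not overlap because \<open>m + M \<le> a\<close>, and the total is
    \<open>a\<^bsup>k+1\<^esup> + h m\<^sup>k + w\<close>.
  The first corner covers all residues \<open>0 \<le> w < m\<^sup>k\<close>, since \<open>m\<^sup>k \<le> M\<^sup>k - C M\<^bsup>k-1\<^esup>\<close>.  Given \<open>u\<close>, choose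
  the largest \<open>m\<close> with \<open>a\<^bsup>k+1\<^esup> \<le> u\<close>; then \<open>h\<close> is bounded by a constant depending on \<open>k\<close> and \<open>C\<close> only, so everything fits
  into \<open>S(r)\<close> when \<open>u\<close> stays below \<open>r\<^bsup>k+1\<^esup>\<close> by a large enough multiple of \<open>r\<^sup>k\<close>
  (\<open>lattice_config_extend\<close>, \<open>lattice_config_exists\<close>).
\<close>

section \<open>Shears preserve Lebesgue measure\<close>

lemma nn_integral_lborel_translate:
  fixes h :: "'a::euclidean_space \<Rightarrow> ennreal"
  assumes [measurable]: "h \<in> borel_measurable borel"
  shows "(\<integral>\<^sup>+x. h (c + x) \<partial>lborel) = (\<integral>\<^sup>+x. h x \<partial>lborel)"
proof -
  have "(\<integral>\<^sup>+x. h x \<partial>lborel) = (\<integral>\<^sup>+x. h x \<partial>(distr lborel borel ((+) c)))"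
    by (simp add: lborel_distr_plus)
  also have "\<dots> = (\<integral>\<^sup>+x. h (c + x) \<partial>lborel)"
    by (simp add: nn_integral_distr)
  finally show ?thesis by simp
qed

lemma nn_integral_lborel_reflect:
  fixes h :: "'a::euclidean_space \<Rightarrow> ennreal"
  assumes [measurable]: "h \<in> borel_measurable borel"
  shows "(\<integral>\<^sup>+x. h (c - x) \<partial>lborel) = (\<integral>\<^sup>+x. h x \<partial>lborel)"
proof -
  have "(\<integral>\<^sup>+x. h x \<partial>lborel)
      = (\<integral>\<^sup>+x. h x \<partial>(density (distr lborel borel (\<lambda>x. c + (-1) *\<^sub>R x)) (\<lambda>_. \<bar>-1::real\<bar>^DIM('a))))"
    using lborel_affine[of "-1" c] by simp
  also have "\<dots> = (\<integral>\<^sup>+x. h (c - x) \<partial>lborel)"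
    by (simp add: nn_integral_density nn_integral_distr)
  finally show ?thesis by simp
qed

text \<open>
  The uniqueness argument for Haar measure, specialized.  By Fubini and translation invariance,
  \<open>|g\<^sup>-\<^sup>1 A| |B| = |A| |g\<^sup>-\<^sup>1 B|\<close> for all Borel sets \<open>A\<close> and \<open>B\<close>.  Since \<open>g\<close> is an involution there is a
  bounded neighbourhood \<open>B\<close> of the origin with \<open>g\<^sup>-\<^sup>1 B = B\<close>, and its volume cancels.
\<close>

lemma emeasure_linear_involution:
  fixes g :: "'a::euclidean_space \<Rightarrow> 'a"
  assumes lin: "linear g" and inv: "\<And>x. g (g x) = x" and A: "A \<in> sets borel"
  shows "emeasure lborel (g -` A) = emeasure lborel A"
proof -
  have cont: "continuous_on UNIV g"
    using lin by (simp add: linear_continuous_on linear_linear)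
  then have g [measurable]: "g \<in> borel_measurable borel"
    by (rule borel_measurable_continuous_onI)
  have [measurable]: "A \<in> sets borel" by fact
  have pre: "g -` S \<in> sets borel" if "S \<in> sets borel" for S
    using measurable_sets[OF g that] by simp
  define B where "B = ball 0 1 \<union> g -` ball (0::'a) 1"
  have openB: "open B"
    unfolding B_def using cont by (intro open_Un open_ball open_vimage) auto
  then have [measurable]: "B \<in> sets borel" by simp
  have gB: "g -` B = B"
    unfolding B_def using inv by auto
  have "g -` ball 0 1 = g ` ball 0 1"
  proof (intro set_eqI iffI)
    fix x assume "x \<in> g -` ball 0 1"
    then show "x \<in> g ` ball 0 1" by (intro image_eqI[of _ _ "g x"]) (simp_all add: inv)
  qed (auto simp: inv)
  then have "bounded B"
    unfolding B_def using bounded_linear_image[OF bounded_ball, of g 0 1] lin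
    by (simp add: linear_linear)
  then have finB: "emeasure lborel B < \<infinity>"
    by (rule emeasure_bounded_finite)
  have "0 \<in> B" by (simp add: B_def)
  then have posB: "emeasure lborel B \<noteq> 0"
    using open_not_negligible[OF openB] null_sets_completionI[of B lborel]
    by (auto simp: negligible_iff_null_sets null_sets_def)
  have "emeasure lborel (g -` A) * emeasure lborel B
     = (\<integral>\<^sup>+z. (\<integral>\<^sup>+y. indicator A (g z) * indicator B (g z + y) \<partial>lborel) \<partial>lborel)"
  proof -
    have "(\<integral>\<^sup>+y. indicator A (g z) * indicator B (g z + y) \<partial>lborel)
        = indicator (g -` A) z * emeasure lborel B" for z
      using nn_integral_lborel_translate[of "indicator B" "g z"]
      by (cases "g z \<in> A") simp_all
    then show ?thesis by (simp add: nn_integral_multc pre A)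
  qed
  also have "\<dots> = (\<integral>\<^sup>+y. (\<integral>\<^sup>+z. indicator A (g z) * indicator B (g z + y) \<partial>lborel) \<partial>lborel)"
    by (rule lborel_pair.Fubini'[symmetric]) measurable
  also have "\<dots> = (\<integral>\<^sup>+y. (\<integral>\<^sup>+z. indicator A (g z - y) * indicator B (g z) \<partial>lborel) \<partial>lborel)"
  proof (rule nn_integral_cong)
    fix y
    have "g (- g y + z) = g z - y" for z
      using lin inv by (simp add: linear_diff)
    then show "(\<integral>\<^sup>+z. indicator A (g z) * indicator B (g z + y) \<partial>lborel)
        = (\<integral>\<^sup>+z. indicator A (g z - y) * (indicator B (g z) :: ennreal) \<partial>lborel)"
      using nn_integral_lborel_translate
        [of "\<lambda>z. indicator A (g z) * indicator B (g z + y)" "- g y"]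
      by simp
  qed
  also have "\<dots> = (\<integral>\<^sup>+z. (\<integral>\<^sup>+y. indicator A (g z - y) * indicator B (g z) \<partial>lborel) \<partial>lborel)"
    by (rule lborel_pair.Fubini') measurable
  also have "\<dots> = emeasure lborel A * emeasure lborel (g -` B)"
  proof -
    have "(\<integral>\<^sup>+y. indicator A (g z - y) * indicator B (g z) \<partial>lborel)
        = emeasure lborel A * indicator (g -` B) z" for z
      using nn_integral_lborel_reflect[of "indicator A" "g z"]
      by (cases "g z \<in> B") simp_all
    then show ?thesis by (simp add: nn_integral_cmult pre)
  qed
  finally show ?thesis
    using finB posB gB by (auto simp: mult.commute[of _ "emeasure lborel B"] ennreal_mult_cancel_left)
qed

text \<open>
  A shear in direction \<open>e\<^sub>i\<close> followed by the reflection in \<open>e\<^sub>i\<close> is an involution, so a shear is a product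
  of two linear involutions.
\<close>

lemma emeasure_shear:
  fixes c :: "real ^ 'n"
  assumes c: "c $ i = 0" and A: "A \<in> sets borel"
  shows "emeasure lborel ((\<lambda>x. x + (c \<bullet> x) *\<^sub>R axis i 1) -` A) = emeasure lborel A"
proof -
  let ?R = "\<lambda>x::real^'n. x - (2 * x $ i) *\<^sub>R axis i 1"
  let ?g = "\<lambda>x::real^'n. x - (2 * x $ i + c \<bullet> x) *\<^sub>R axis i 1"
  have linR: "linear ?R"
    by (intro linearI) (simp_all add: vec_eq_iff algebra_simps)
  have ling: "linear ?g"
    by (intro linearI) (simp_all add: vec_eq_iff inner_add_right algebra_simps)
  have RR: "?R (?R x) = x" for x
    by (simp add: vec_eq_iff axis_def)
  have gg: "?g (?g x) = x" for x
  proof -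
    have "c \<bullet> axis i 1 = 0" by (simp add: inner_axis c)
    then have "c \<bullet> ?g x = c \<bullet> x" by (simp add: inner_diff_right)
    then show ?thesis by (simp add: vec_eq_iff axis_def)
  qed
  have f: "(\<lambda>x. x + (c \<bullet> x) *\<^sub>R axis i 1) = ?R \<circ> ?g"
    by (rule ext) (simp add: vec_eq_iff axis_def)
  have RA: "?R -` A \<in> sets borel"
    using linR A by (intro measurable_sets_borel borel_measurable_continuous_onI)
      (auto simp: linear_continuous_on linear_linear)
  show ?thesis
    unfolding f vimage_comp[symmetric]
    using emeasure_linear_involution[OF ling gg RA] emeasure_linear_involution[OF linR RR A] by simp
qed

section \<open>Newton polyhedra and covolume\<close>

text \<open>
  For finite \<open>X\<close> in the positive orthant, the part of this set inside the orthant is the convex hull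
  of \<open>X\<close> plus the orthant.  The description by half-spaces with nonnegative normal vector \<open>w\<close> reduces
  membership to estimates for one functional at a time.
\<close>

definition newton_polyhedron :: "(real ^ 'n) set \<Rightarrow> (real ^ 'n) set" where
  "newton_polyhedron X = {x. \<forall>w. 0 \<le> w \<and> (\<forall>p\<in>X. 1 \<le> w \<bullet> p) \<longrightarrow> 1 \<le> w \<bullet> x}"

definition under :: "(real ^ 'n) set \<Rightarrow> (real ^ 'n) set" where
  "under X = {x. 0 \<le> x} - newton_polyhedron X"

definition covolume :: "(real ^ 'n) set \<Rightarrow> real" where
  "covolume X = fact CARD('n) * measure lebesgue (under X)"

lemma nonneg_vec_iff: "0 \<le> x \<longleftrightarrow> (\<forall>j. 0 \<le> x $ j)" for x :: "real ^ 'n"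
  by (simp add: less_eq_vec_def)

lemma inner_vec_sum: "w \<bullet> x = (\<Sum>j\<in>UNIV. w $ j * x $ j)" for w x :: "real ^ 'n"
  by (simp add: inner_vec_def)

lemma newton_polyhedronI:
  assumes "\<And>w. 0 \<le> w \<Longrightarrow> (\<And>p. p \<in> X \<Longrightarrow> 1 \<le> w \<bullet> p) \<Longrightarrow> 1 \<le> w \<bullet> x"
  shows "x \<in> newton_polyhedron X"
  using assms by (auto simp: newton_polyhedron_def)

lemma subset_newton_polyhedron: "p \<in> X \<Longrightarrow> p \<in> newton_polyhedron X"
  by (auto simp: newton_polyhedron_def)

lemma underI:
  assumes "0 \<le> x" "0 \<le> w" "\<And>p. p \<in> X \<Longrightarrow> 1 \<le> w \<bullet> p" "w \<bullet> x < 1"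
  shows "x \<in> under X"
  using assms by (force simp: under_def newton_polyhedron_def)

lemma underE:
  assumes "x \<in> under X"
  obtains w where "0 \<le> w" "\<And>p. p \<in> X \<Longrightarrow> 1 \<le> w \<bullet> p" "w \<bullet> x < 1" "0 \<le> x"
  using assms by (force simp: under_def newton_polyhedron_def)

lemma closed_newton_polyhedron: "closed (newton_polyhedron X)"
proof -
  have "newton_polyhedron X = (\<Inter>w\<in>{w. 0 \<le> w \<and> (\<forall>p\<in>X. 1 \<le> w \<bullet> p)}. {x. 1 \<le> w \<bullet> x})"
    by (auto simp: newton_polyhedron_def)
  then show ?thesis
    using closed_halfspace_ge by (auto intro!: closed_INT)
qed

lemma convex_newton_polyhedron: "convex (newton_polyhedron X)"
proof -
  have "newton_polyhedron X = (\<Inter>w\<in>{w. 0 \<le> w \<and> (\<forall>p\<in>X. 1 \<le> w \<bullet> p)}. {x. 1 \<le> w \<bullet> x})"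
    by (auto simp: newton_polyhedron_def)
  then show ?thesis
    using convex_halfspace_ge by (auto intro!: convex_INT)
qed

lemma borel_under: "under X \<in> sets borel"
proof -
  have "closed {x::real^'n. 0 \<le> x}"
    using closed_eucl_atLeast[of "0::real^'n"] by (simp add: atLeast_def)
  then show ?thesis
    unfolding under_def using closed_newton_polyhedron[of X] by (intro sets.Diff) auto
qed

lemma newton_polyhedron_above_axis:
  assumes "axis j s \<in> X" "s \<le> x $ j" "0 \<le> x"
  shows "x \<in> newton_polyhedron X"
proof (rule newton_polyhedronI)
  fix w :: "real ^ 'a" assume w: "0 \<le> w" and "\<And>p. p \<in> X \<Longrightarrow> 1 \<le> w \<bullet> p"
  then have "1 \<le> w $ j * s" using assms(1) by (force simp: inner_axis)
  also have "\<dots> \<le> w $ j * x $ j" using assms w by (simp add: nonneg_vec_iff mult_left_mono)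
  also have "\<dots> \<le> w \<bullet> x"
    unfolding inner_vec_sum using w assms by (intro member_le_sum) (auto simp: nonneg_vec_iff)
  finally show "1 \<le> w \<bullet> x" .
qed

text \<open>
  A functional that is at least 1 at \<open>s e\<^sub>j\<close>, where \<open>s \<le> t\<^sub>j\<close>, has \<open>j\<close>-th coefficient at least \<open>1 / t\<^sub>j\<close>.
\<close>

lemma under_below_axes:
  assumes x: "x \<in> under X" and ax: "\<And>j. \<exists>s\<le>t j. axis j s \<in> X"
  shows "(\<Sum>j\<in>UNIV. x $ j / t j) < 1"
proof -
  obtain w where w: "0 \<le> w" "\<And>p. p \<in> X \<Longrightarrow> 1 \<le> w \<bullet> p" "w \<bullet> x < 1" "0 \<le> x"
    using underE[OF x] by metis
  have "x $ j / t j \<le> w $ j * x $ j" for j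
  proof -
    obtain s where s: "s \<le> t j" "axis j s \<in> X" using ax by blast
    have wj: "0 \<le> w $ j" "0 \<le> x $ j" using w by (simp_all add: nonneg_vec_iff)
    have "1 \<le> w $ j * s" using w(2)[OF s(2)] by (simp add: inner_axis)
    then have "1 \<le> w $ j * t j" using mult_left_mono[OF s(1) wj(1)] by linarith
    moreover from this have "0 < t j" using wj(1) by (metis less_eq_real_def mult_le_0_iff not_le zero_less_one order.strict_trans2)
    ultimately have "1 / t j \<le> w $ j" by (simp add: field_simps)
    then show ?thesis using mult_right_mono[OF _ wj(2), of "1 / t j" "w $ j"] by simp
  qed
  then have "(\<Sum>j\<in>UNIV. x $ j / t j) \<le> w \<bullet> x"
    unfolding inner_vec_sum by (intro sum_mono)
  then show ?thesis using w(3) by linarith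
qed

lemma under_axes:
  assumes t: "\<And>j. 0 < t j"
  shows "under (range (\<lambda>j. axis j (t j))) = {x. 0 \<le> x \<and> (\<Sum>j\<in>UNIV. x $ j / t j) < 1}"
proof (intro set_eqI iffI)
  fix x assume x: "x \<in> under (range (\<lambda>j. axis j (t j)))"
  then show "x \<in> {x. 0 \<le> x \<and> (\<Sum>j\<in>UNIV. x $ j / t j) < 1}"
    using under_below_axes[OF x, of t] by (auto simp: under_def)
next
  fix x :: "real ^ 'a" assume x: "x \<in> {x. 0 \<le> x \<and> (\<Sum>j\<in>UNIV. x $ j / t j) < 1}"
  show "x \<in> under (range (\<lambda>j. axis j (t j)))"
  proof (rule underI[where w = "\<chi> j. 1 / t j"])
    show "0 \<le> (\<chi> j. 1 / t j)" using t by (simp add: nonneg_vec_iff less_imp_le)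
    show "1 \<le> (\<chi> j. 1 / t j) \<bullet> p" if "p \<in> range (\<lambda>j. axis j (t j))" for p
      using that t by (auto simp: inner_axis less_imp_neq[THEN not_sym])
  qed (use x in \<open>auto simp: inner_vec_sum\<close>)
qed

lemma lmeasurable_under:
  assumes ax: "\<And>j. \<exists>s. axis j s \<in> X"
  shows "under X \<in> lmeasurable"
proof -
  obtain t where t: "\<And>j. axis j (t j) \<in> X" using ax by metis
  have "under X \<subseteq> cbox 0 (\<chi> j. t j)"
  proof
    fix x assume x: "x \<in> under X"
    then have "0 \<le> x" by (simp add: under_def)
    moreover have "x $ j \<le> t j" for j
      using newton_polyhedron_above_axis[OF t, of j x] x by (fastforce simp: under_def)
    ultimately show "x \<in> cbox 0 (\<chi> j. t j)"
      by (simp add: mem_box_cart nonneg_vec_iff)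
  qed
  then have "bounded (under X)" by (rule bounded_subset[OF bounded_cbox])
  then show ?thesis
    using borel_under[of X] by (intro bounded_set_imp_lmeasurable) auto
qed

lemma std_simplex_cart:
  "convex hull (insert 0 Basis) = {x :: real ^ 'n. 0 \<le> x \<and> (\<Sum>j\<in>UNIV. x $ j) \<le> 1}"
proof -
  have B: "(Basis :: (real^'n) set) = range (\<lambda>j. axis j 1)"
    by (auto simp: Basis_vec_def)
  have inj: "inj (\<lambda>j::'n. axis j (1::real))"
    by (auto simp: inj_def axis_eq_axis)
  show ?thesis
    unfolding std_simplex unfolding B sum.reindex[OF inj]
    by (simp add: nonneg_vec_iff inner_axis)
qed

text \<open>
  The open and the closed facet \<open>\<Sum>x\<^sub>j = 1\<close> differ by a null set.  The half-open simplex is the one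
  below a Newton polyhedron, the closed one is \<open>S(1)\<close>.
\<close>

lemma measure_std_simplex_cart:
  fixes S :: "(real ^ 'n) set"
  assumes "S = {x. 0 \<le> x \<and> (\<Sum>j\<in>UNIV. x $ j) < 1} \<or> S = {x. 0 \<le> x \<and> (\<Sum>j\<in>UNIV. x $ j) \<le> 1}"
  shows "S \<in> lmeasurable" "measure lebesgue S = 1 / fact CARD('n)"
proof -
  let ?C = "convex hull (insert 0 Basis) :: (real ^ 'n) set"
  let ?one = "(\<chi> j. 1) :: real ^ 'n"
  have C: "compact ?C" by (intro finite_imp_compact_convex_hull) simp
  then have Cm: "?C \<in> lmeasurable" by (rule lmeasurable_compact)
  have mC: "measure lebesgue ?C = 1 / fact CARD('n)"
    using content_std_simplex[where 'a = "real ^ 'n"] C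
    by (simp add: measure_completion compact_imp_closed borel_closed)
  have "negligible {x. ?one \<bullet> x = 1}"
    by (rule negligible_hyperplane) simp
  moreover have "(?C - S) \<union> (S - ?C) \<subseteq> {x. ?one \<bullet> x = 1}"
    using assms by (auto simp: std_simplex_cart inner_vec_sum)
  ultimately have neg: "negligible ((?C - S) \<union> (S - ?C))"
    by (rule negligible_subset)
  show "measure lebesgue S = 1 / fact CARD('n)"
    using measure_negligible_symdiff[OF Cm neg] mC by simp
  show "S \<in> lmeasurable"
    using Cm neg by (rule lmeasurable_negligible_symdiff)
qed

text \<open>
  If some \<open>t\<^sub>j\<close> is zero then the origin belongs to the configuration and nothing lies below it.
\<close>

lemma covolume_axes:
  fixes t :: "'n::finite \<Rightarrow> real"
  assumes t: "\<And>j. 0 \<le> t j"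
  shows "covolume (range (\<lambda>j. axis j (t j) :: real ^ 'n)) = prod t UNIV"
proof (cases "\<forall>j. 0 < t j")
  case True
  let ?S = "{x :: real ^ 'n. 0 \<le> x \<and> (\<Sum>j\<in>UNIV. x $ j) < 1}"
  have "under (range (\<lambda>j. axis j (t j) :: real ^ 'n)) = (\<lambda>x. \<chi> k. t k * x $ k) ` ?S"
  proof (subst under_axes)
    show "{x. 0 \<le> x \<and> (\<Sum>j\<in>UNIV. x $ j / t j) < 1} = (\<lambda>x. \<chi> k. t k * x $ k) ` ?S" (is "?L = ?R")
    proof (intro set_eqI iffI)
      fix x assume "x \<in> ?L"
      then have "(\<chi> k. x $ k / t k) \<in> ?S"
        using t by (auto simp: nonneg_vec_iff)
      moreover have "x = (\<chi> k. t k * (\<chi> k. x $ k / t k) $ k)"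
        using True by (simp add: vec_eq_iff less_imp_neq[THEN not_sym])
      ultimately show "x \<in> ?R" by blast
    next
      fix x assume "x \<in> ?R"
      then show "x \<in> ?L"
        using True by (auto simp: nonneg_vec_iff less_imp_le less_imp_neq[THEN not_sym])
    qed
  qed (use True in auto)
  then show ?thesis
    using measure_std_simplex_cart[of ?S] measure_stretch[of ?S t] t
    by (simp add: covolume_def prod_nonneg)
next
  case False
  then obtain j where "t j = 0" using t by (metis less_eq_real_def)
  then have "axis j 0 \<in> range (\<lambda>j. axis j (t j) :: real ^ 'n)" by (metis rangeI)
  then have "under (range (\<lambda>j. axis j (t j) :: real ^ 'n)) = {}"
    using newton_polyhedron_above_axis[of j 0] by (auto simp: under_def nonneg_vec_iff)
  moreover have "prod t UNIV = 0" using \<open>t j = 0\<close> by (auto intro: prod_zero)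
  ultimately show ?thesis by (simp add: covolume_def)
qed

section \<open>Filling the corners of a simplex\<close>

text \<open>
  The simplex to be modified has the vertices \<open>b\<^sub>j e\<^sub>j\<close>, and \<open>level b\<close> is 1 on its outer facet.  The map
  \<open>straighten b i\<close> introduces coordinates at the vertex \<open>b\<^sub>i e\<^sub>i\<close>: the outer facet becomes the
  hyperplane \<open>x\<^sub>i = 0\<close>, the vertex becomes the origin and all other coordinates are kept.
  Its inverse is \<open>corner b i\<close>.
\<close>

definition level :: "('n \<Rightarrow> real) \<Rightarrow> real ^ 'n \<Rightarrow> real" where
  "level b x = (\<Sum>j\<in>UNIV. x $ j / b j)"

definition straighten :: "('n \<Rightarrow> real) \<Rightarrow> 'n \<Rightarrow> real ^ 'n \<Rightarrow> real ^ 'n" where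
  "straighten b i x = (\<chi> j. if j = i then b i * (level b x - 1) else x $ j)"

definition corner :: "('n \<Rightarrow> real) \<Rightarrow> 'n \<Rightarrow> real ^ 'n \<Rightarrow> real ^ 'n" where
  "corner b i y = (\<chi> j. if j = i then y $ i + b i * (1 - (\<Sum>k\<in>-{i}. y $ k / b k)) else y $ j)"

lemma sum_UNIV_remove: "(\<Sum>j\<in>UNIV. f j) = f i + (\<Sum>j\<in>-{i}. f j)"
  for f :: "'n::finite \<Rightarrow> real"
  by (simp add: sum.remove[of UNIV i] Compl_eq_Diff_UNIV)

lemma level_corner:
  assumes "b i \<noteq> 0"
  shows "level b (corner b i y) = 1 + y $ i / b i"
proof -
  have "(\<Sum>k\<in>-{i}. corner b i y $ k / b k) = (\<Sum>k\<in>-{i}. y $ k / b k)"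
    by (intro sum.cong) (auto simp: corner_def)
  moreover have "corner b i y $ i / b i = y $ i / b i + (1 - (\<Sum>k\<in>-{i}. y $ k / b k))"
    using assms by (simp add: corner_def field_simps)
  ultimately show ?thesis
    unfolding level_def sum_UNIV_remove[of _ i] by simp
qed

lemma straighten_corner: "b i \<noteq> 0 \<Longrightarrow> straighten b i (corner b i y) = y"
  by (simp add: straighten_def level_corner vec_eq_iff) (simp add: corner_def)

lemma straighten_eq_shear:
  assumes "b i \<noteq> 0"
  shows "straighten b i x
    = - axis i (b i) + (x + ((\<chi> j. if j = i then 0 else b i / b j) \<bullet> x) *\<^sub>R axis i 1)"
proof -
  have "(\<chi> j. if j = i then 0 else b i / b j) \<bullet> x = b i * (\<Sum>j\<in>-{i}. x $ j / b j)"
    unfolding inner_vec_sum sum_UNIV_remove[of _ i] sum_distrib_left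
    by simp
  moreover have "b i * (level b x - 1) = x $ i + b i * (\<Sum>j\<in>-{i}. x $ j / b j) - b i"
    unfolding level_def sum_UNIV_remove[of _ i] using assms by (simp add: algebra_simps)
  ultimately show ?thesis
    by (simp add: straighten_def vec_eq_iff axis_def)
qed

lemma emeasure_straighten:
  assumes "b i \<noteq> 0" and U: "U \<in> sets borel"
  shows "straighten b i -` U \<in> sets borel"
    and "emeasure lborel (straighten b i -` U) = emeasure lborel U"
proof -
  let ?c = "(\<chi> j. if j = i then 0 else b i / b j)"
  let ?f = "\<lambda>x. x + (?c \<bullet> x) *\<^sub>R axis i 1"
  have eq: "straighten b i -` U = ?f -` ((+) (- axis i (b i)) -` U)"
    using straighten_eq_shear[of b i] assms(1) by auto
  have V: "(+) (- axis i (b i)) -` U \<in> sets borel"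
    using measurable_sets_borel[OF _ U, of "(+) (- axis i (b i))"] by simp
  show "straighten b i -` U \<in> sets borel"
    unfolding eq by (rule measurable_sets_borel[OF _ V]) simp
  have "emeasure lborel ((+) (- axis i (b i)) -` U)
      = emeasure (distr lborel borel ((+) (- axis i (b i)))) U"
    using U by (subst emeasure_distr) auto
  also have "\<dots> = emeasure lborel U"
    by (simp only: lborel_distr_plus)
  finally show "emeasure lborel (straighten b i -` U) = emeasure lborel U"
    unfolding eq using emeasure_shear[OF _ V, of ?c i] by simp
qed

text \<open>
  A functional \<open>w\<close> and its expression \<open>v\<close> in the coordinates at the vertex \<open>b\<^sub>i e\<^sub>i\<close>.  The constant
  term is the value of \<open>w\<close> at this vertex.
\<close>

lemma inner_straighten:
  assumes b: "\<And>j. b j \<noteq> 0" and wi: "w $ i = v $ i"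
    and wj: "\<And>j. j \<noteq> i \<Longrightarrow> w $ j = v $ j + v $ i * b i / b j"
  shows "w \<bullet> z = v $ i * b i + v \<bullet> straighten b i z"
proof -
  have "(\<Sum>j\<in>-{i}. w $ j * z $ j)
      = (\<Sum>j\<in>-{i}. v $ j * z $ j) + v $ i * b i * (\<Sum>j\<in>-{i}. z $ j / b j)"
    unfolding sum_distrib_left sum.distrib[symmetric]
    by (intro sum.cong) (auto simp: wj algebra_simps)
  moreover have "v \<bullet> straighten b i z
      = v $ i * (b i * (level b z - 1)) + (\<Sum>j\<in>-{i}. v $ j * z $ j)"
    unfolding inner_vec_sum sum_UNIV_remove[of _ i]
    by (simp add: straighten_def)
  moreover have "b i * level b z = z $ i + b i * (\<Sum>j\<in>-{i}. z $ j / b j)"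
    unfolding level_def sum_UNIV_remove[of _ i] using b by (simp add: algebra_simps)
  ultimately show ?thesis
    unfolding inner_vec_sum[of w] sum_UNIV_remove[of _ i] wi
    by (simp add: algebra_simps)
qed

text \<open>
  The regions below the separate corners fit together.  Let the functional \<open>w\<close> separate \<open>x\<close> from the
  configuration, and choose the vertex \<open>b\<^sub>i e\<^sub>i\<close> at which \<open>w\<close> is smallest.  In the coordinates at this
  vertex \<open>w\<close> still has nonnegative coefficients, hence it separates \<open>x\<close> from the \<open>i\<close>-th corner alone.
  The hypothesis \<open>compat\<close>, that all points of the other corners lie above the \<open>i\<close>-th one, gives the
  converse.  A vertex that is left alone is represented by \<open>Y i = {0}\<close>.
\<close>

lemma under_corners:
  fixes b :: "'n::finite \<Rightarrow> real"
  assumes b: "\<And>j. 0 < b j"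
    and Y: "\<And>i y. y \<in> Y i \<Longrightarrow> 0 \<le> y $ i"
    and compat: "\<And>i j y. y \<in> Y j \<Longrightarrow> i \<noteq> j \<Longrightarrow> straighten b i (corner b j y) \<in> newton_polyhedron (Y i)"
  shows "under (\<Union>i. corner b i ` Y i) = {x. 0 \<le> x \<and> level b x < 1}
      \<union> (\<Union>i. {x. 0 \<le> x \<and> 1 \<le> level b x \<and> straighten b i x \<in> under (Y i)})"
    (is "under ?X = ?B \<union> ?C")
proof (intro set_eqI iffI)
  have b0: "b j \<noteq> 0" for j using b[of j] by simp
  {
    fix x assume "x \<in> under ?X"
    then obtain w where w: "0 \<le> w" "\<And>p. p \<in> ?X \<Longrightarrow> 1 \<le> w \<bullet> p" "w \<bullet> x < 1" "0 \<le> x"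
      by (rule underE) blast
    obtain i where i: "\<And>j. w $ i * b i \<le> w $ j * b j"
      using ex_is_arg_min_if_finite[of UNIV "\<lambda>j. w $ j * b j"] by (auto simp: is_arg_min_linorder)
    show "x \<in> ?B \<union> ?C"
    proof (cases "level b x < 1")
      case False
      \<comment> \<open>Subtracting the multiple \<open>k\<close> of \<open>level b\<close> from \<open>w\<close> leaves nonnegative coefficients by the choice of \<open>i\<close>.\<close>
      define k where "k = w $ i * b i"
      define v where "v = (\<chi> j. if j = i then w $ i else w $ j - k / b j)"
      have v0: "0 \<le> v"
        using i b w(1) by (auto simp: v_def k_def nonneg_vec_iff pos_divide_le_eq)
      have wv: "w \<bullet> z = k + v \<bullet> straighten b i z" for z
        using inner_straighten[where b = b and w = w and v = v and i = i and z = z, OF b0] by (simp add: v_def k_def)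
      have s0: "0 \<le> straighten b i x"
        using False w(4) b[of i] by (auto simp: straighten_def nonneg_vec_iff)
      have "0 \<le> v \<bullet> straighten b i x"
        unfolding inner_vec_sum using v0 s0 by (intro sum_nonneg mult_nonneg_nonneg) (auto simp: nonneg_vec_iff)
      then have k1: "k < 1" using wv[of x] w(3) by linarith
      have "straighten b i x \<in> under (Y i)"
      proof (rule underI[OF s0, where w = "v /\<^sub>R (1 - k)"])
        show "0 \<le> v /\<^sub>R (1 - k)" using v0 k1 by (simp add: nonneg_vec_iff)
        show "1 \<le> (v /\<^sub>R (1 - k)) \<bullet> y" if "y \<in> Y i" for y
        proof -
          have "1 \<le> w \<bullet> corner b i y" using that by (intro w(2)) auto
          then have "1 - k \<le> v \<bullet> y" using wv[of "corner b i y"] by (simp add: straighten_corner b0)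
          then show ?thesis using k1 by (simp add: field_simps)
        qed
        show "(v /\<^sub>R (1 - k)) \<bullet> straighten b i x < 1"
          using wv[of x] w(3) k1 by (simp add: field_simps)
      qed
      then show ?thesis using False w(4) by auto
    qed (use w(4) in auto)
  next
    fix x assume "x \<in> ?B \<union> ?C"
    then consider "0 \<le> x" "level b x < 1"
      | i where "0 \<le> x" "1 \<le> level b x" "straighten b i x \<in> under (Y i)" by auto
    then show "x \<in> under ?X"
    proof cases
      case 1
      have lev: "(\<chi> j. 1 / b j) \<bullet> z = level b z" for z
        by (simp add: inner_vec_sum level_def)
      show ?thesis
      proof (rule underI[OF 1(1), where w = "\<chi> j. 1 / b j"])
        show "0 \<le> (\<chi> j. 1 / b j)" using b by (simp add: nonneg_vec_iff less_imp_le)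
        show "1 \<le> (\<chi> j. 1 / b j) \<bullet> p" if "p \<in> ?X" for p
          using that Y b by (auto simp: lev level_corner b0 less_imp_le)
      qed (use 1 in \<open>simp add: lev\<close>)
    next
      case 2
      from 2(3) obtain v where v: "0 \<le> v" "\<And>y. y \<in> Y i \<Longrightarrow> 1 \<le> v \<bullet> y" "v \<bullet> straighten b i x < 1"
        by (rule underE) blast
      define k where "k = v $ i * b i"
      define w where "w = (\<chi> j. if j = i then v $ i else v $ j + k / b j)"
      have k0: "0 \<le> k" using v(1) b[of i] by (simp add: k_def nonneg_vec_iff)
      have wv: "w \<bullet> z = k + v \<bullet> straighten b i z" for z
        using inner_straighten[where b = b and w = w and v = v and i = i and z = z, OF b0] by (simp add: w_def k_def)
      show ?thesis
      proof (rule underI[OF 2(1), where w = "w /\<^sub>R (1 + k)"])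
        show "0 \<le> w /\<^sub>R (1 + k)"
          using v(1) k0 b by (auto simp: w_def nonneg_vec_iff less_imp_le)
        show "1 \<le> (w /\<^sub>R (1 + k)) \<bullet> p" if p: "p \<in> ?X" for p
        proof -
          obtain j y where y: "y \<in> Y j" "p = corner b j y" using p by blast
          have "straighten b i p \<in> newton_polyhedron (Y i)"
            using y compat[of y j i] by (cases "i = j") (auto simp: straighten_corner b0 intro: subset_newton_polyhedron)
          then have "1 \<le> v \<bullet> straighten b i p" using v by (auto simp: newton_polyhedron_def)
          then show ?thesis using wv[of p] k0 by (simp add: field_simps)
        qed
        show "(w /\<^sub>R (1 + k)) \<bullet> x < 1" using wv[of x] v(3) k0 by (simp add: field_simps)
      qed
    qed
  }
qed

text \<open>
  Straightening preserves volume, and the region below a corner lies automatically in the orthant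
  beyond the outer facet: the axis points of \<open>Y i\<close> do not reach beyond the other vertices.
\<close>

lemma covolume_corners:
  fixes b :: "'n::finite \<Rightarrow> real"
  assumes b: "\<And>j. 0 < b j"
    and Y: "\<And>i y. y \<in> Y i \<Longrightarrow> 0 \<le> y $ i"
    and compat: "\<And>i j y. y \<in> Y j \<Longrightarrow> i \<noteq> j \<Longrightarrow> straighten b i (corner b j y) \<in> newton_polyhedron (Y i)"
    and axes: "\<And>i j. \<exists>s. axis j s \<in> Y i \<and> (j \<noteq> i \<longrightarrow> s \<le> b j)"
    and disj: "\<And>i j x. i \<noteq> j \<Longrightarrow> 0 \<le> x \<Longrightarrow> 1 \<le> level b x
      \<Longrightarrow> straighten b i x \<in> under (Y i) \<Longrightarrow> straighten b j x \<in> under (Y j) \<Longrightarrow> False"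
  shows "covolume (\<Union>i. corner b i ` Y i) = prod b UNIV + (\<Sum>i\<in>UNIV. covolume (Y i))"
proof -
  let ?B = "{x. 0 \<le> x \<and> level b x < 1}"
  define C where "C i = straighten b i -` under (Y i)" for i
  have b0: "b j \<noteq> 0" for j using b[of j] by simp
  have C_eq: "{x. 0 \<le> x \<and> 1 \<le> level b x \<and> straighten b i x \<in> under (Y i)} = C i" for i
  proof -
    have "0 \<le> x \<and> 1 \<le> level b x" if y: "straighten b i x \<in> under (Y i)" for x
    proof -
      let ?y = "straighten b i x"
      have y0: "0 \<le> ?y" using y by (simp add: under_def)
      then have "0 \<le> ?y $ i" unfolding nonneg_vec_iff ..
      then have lev: "1 \<le> level b x"
        using b[of i] by (simp add: straighten_def zero_le_mult_iff)
      obtain s where s: "axis i s \<in> Y i" using axes by blast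
      \<comment> \<open>Along the \<open>i\<close>-th axis any positive bound not below \<open>s\<close> serves, since that summand is dropped.\<close>
      let ?t = "\<lambda>j. if j = i then max s 1 else b j"
      have "\<exists>s\<le>?t j. axis j s \<in> Y i" for j
      proof (cases "j = i")
        case True
        then show ?thesis using s by (intro exI[of _ s]) simp
      qed (use axes[of j i] in auto)
      from under_below_axes[OF y this]
      have "(\<Sum>j\<in>UNIV. ?y $ j / ?t j) < 1" .
      moreover have "(\<Sum>j\<in>-{i}. ?y $ j / ?t j) = (\<Sum>j\<in>-{i}. x $ j / b j)"
        by (intro sum.cong) (auto simp: straighten_def)
      ultimately have "(\<Sum>j\<in>-{i}. x $ j / b j) < 1"
        using divide_nonneg_pos[OF \<open>0 \<le> ?y $ i\<close>, of "max s 1"]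
        unfolding sum_UNIV_remove[of _ i] by (simp add: max_def split: if_splits)
      then have "0 < x $ i / b i"
        using lev unfolding level_def sum_UNIV_remove[of _ i] by linarith
      then have "0 \<le> x $ i" using b[of i] by (simp add: zero_less_divide_iff)
      moreover have "0 \<le> x $ j" if "j \<noteq> i" for j
        using y0 that by (auto simp: nonneg_vec_iff straighten_def split: if_splits)
      ultimately show ?thesis using lev unfolding nonneg_vec_iff by metis
    qed
    then show ?thesis by (auto simp: C_def)
  qed
  have meas: "C i \<in> lmeasurable \<and> measure lebesgue (C i) = measure lebesgue (under (Y i))" for i
  proof -
    have Cb: "C i \<in> sets borel" "emeasure lborel (C i) = emeasure lborel (under (Y i))"
      using emeasure_straighten[OF b0 borel_under[of "Y i"]] by (simp_all add: C_def)
    then have "emeasure lebesgue (C i) = emeasure lebesgue (under (Y i))"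
      using borel_under[of "Y i"] by simp
    moreover have "under (Y i) \<in> lmeasurable" using axes by (intro lmeasurable_under) blast
    ultimately show ?thesis
      using Cb(1) by (auto simp: fmeasurable_def measure_def)
  qed
  have B: "?B = under (range (\<lambda>j. axis j (b j)))"
    by (simp add: under_axes[OF b] level_def)
  have Bm: "?B \<in> lmeasurable" unfolding B by (intro lmeasurable_under) blast
  have "measure lebesgue (under (\<Union>i. corner b i ` Y i)) = measure lebesgue (?B \<union> (\<Union>i. C i))"
    using under_corners[OF b Y compat] by (simp add: C_eq)
  also have "\<dots> = measure lebesgue ?B + measure lebesgue (\<Union>i. C i)"
  proof (rule measure_Un_AE)
    show "AE x in lebesgue. x \<notin> ?B \<or> x \<notin> (\<Union>i. C i)"
      using C_eq by (intro AE_I2) force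
    show "(\<Union>i. C i) \<in> lmeasurable"
      using meas by (intro fmeasurable.finite_UN) auto
  qed (rule Bm)
  also have "measure lebesgue (\<Union>i. C i) = (\<Sum>i\<in>UNIV. measure lebesgue (C i))"
  proof (rule measure_UNION')
    show "pairwise (\<lambda>i j. disjnt (C i) (C j)) UNIV"
      unfolding pairwise_def disjnt_def using disj C_eq by blast
  qed (use meas in auto)
  finally show ?thesis
    using covolume_axes[of b] b meas
    by (simp add: covolume_def B less_imp_le distrib_left sum_distrib_left)
qed

section \<open>Lattice configurations in few coordinates\<close>

text \<open>
  A configuration that uses the coordinates in \<open>I\<close> and has size \<open>r\<close>.  The weight \<open>r\<close> on the
  remaining coordinates forces a lattice point of the configuration either to have support in
  \<open>I\<close> and coordinate sum at most \<open>r\<close>, or to be the unit vector of one of the remaining axes.  The points on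
  the axes ensure finite covolume.
\<close>

definition lattice_config :: "'n set \<Rightarrow> nat \<Rightarrow> (real ^ 'n) set \<Rightarrow> bool" where
  "lattice_config I r X \<longleftrightarrow> finite X
     \<and> (\<forall>x\<in>X. x \<in> integer_lattice \<and> 0 \<le> x
          \<and> (\<Sum>k\<in>I. x $ k) + real r * (\<Sum>k\<in>-I. x $ k) \<le> real r)
     \<and> (\<forall>j. \<exists>s. axis j s \<in> X)"

lemma sum_axis: "(\<Sum>k\<in>K. axis j s $ k) = (if j \<in> K then s else 0)" for s :: real
proof -
  have "(\<Sum>k\<in>K. axis j s $ k) = (\<Sum>k\<in>K. if k = j then s else 0)"
    by (intro sum.cong) (auto simp: axis_def)
  then show ?thesis by simp
qed

lemma nonneg_axis_iff: "0 \<le> axis j s \<longleftrightarrow> 0 \<le> s" for s :: real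
  by (auto simp: nonneg_vec_iff axis_def)

lemma lattice_config_axisE:
  assumes "lattice_config I r X" "1 \<le> r"
  obtains s where "axis j s \<in> X" "0 \<le> s" "s \<le> (if j \<in> I then real r else 1)"
proof -
  obtain s where s: "axis j s \<in> X"
    using assms(1) by (auto simp: lattice_config_def)
  then have "0 \<le> axis j s"
    "(\<Sum>k\<in>I. axis j s $ k) + real r * (\<Sum>k\<in>-I. axis j s $ k) \<le> real r"
    using assms(1) by (auto simp: lattice_config_def)
  then show ?thesis
    using that[OF s] assms(2) by (auto simp: nonneg_axis_iff sum_axis split: if_splits)
qed

lemma axis_in_integer_lattice: "s \<in> \<int> \<Longrightarrow> axis j s \<in> integer_lattice"
  by (simp add: integer_lattice_def axis_def)

lemma lattice_config_axes:
  assumes "\<And>j. t j \<le> (if j \<in> I then r else 1)"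
  shows "lattice_config I r (range (\<lambda>j. axis j (real (t j))))"
  unfolding lattice_config_def
proof (intro conjI ballI allI)
  fix x assume "x \<in> range (\<lambda>j. axis j (real (t j)))"
  then obtain j where x: "x = axis j (real (t j))" by auto
  show "x \<in> integer_lattice" "0 \<le> x"
    by (simp_all add: x axis_in_integer_lattice nonneg_axis_iff)
  show "(\<Sum>k\<in>I. x $ k) + real r * (\<Sum>k\<in>-I. x $ k) \<le> real r"
    using assms[of j] mult_left_mono[of "real (t j)" 1 "real r"]
    by (auto simp: x sum_axis split: if_splits)
qed auto

lemma newton_polyhedron_above_axes:
  assumes ax: "\<And>k. k \<in> K \<Longrightarrow> 0 < t k \<and> axis k (t k) \<in> X"
    and x: "0 \<le> x" and le: "1 \<le> (\<Sum>k\<in>K. x $ k / t k)"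
  shows "x \<in> newton_polyhedron X"
proof (rule newton_polyhedronI)
  fix w :: "real ^ 'a" assume w: "0 \<le> w" and p: "\<And>p. p \<in> X \<Longrightarrow> 1 \<le> w \<bullet> p"
  note le
  also have "(\<Sum>k\<in>K. x $ k / t k) \<le> (\<Sum>k\<in>K. w $ k * x $ k)"
  proof (rule sum_mono)
    fix k assume k: "k \<in> K"
    then have "1 \<le> w $ k * t k" using ax p[of "axis k (t k)"] by (simp add: inner_axis)
    then have "1 / t k \<le> w $ k" using ax[OF k] by (simp add: field_simps)
    then show "x $ k / t k \<le> w $ k * x $ k"
      using mult_right_mono[of "1 / t k" "w $ k" "x $ k"] x by (simp add: nonneg_vec_iff)
  qed
  also have "\<dots> \<le> w \<bullet> x"
    unfolding inner_vec_sum using w x by (intro sum_mono2) (auto simp: nonneg_vec_iff)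
  finally show "1 \<le> w \<bullet> x" .
qed

lemma newton_polyhedron_zero: "newton_polyhedron {0} = UNIV"
  by (auto simp: newton_polyhedron_def)

lemma corner_axis: "corner b j (axis j s) = axis j (s + b j)"
  by (auto simp: corner_def vec_eq_iff axis_def intro!: sum.neutral)

lemma corner_zero: "corner b j 0 = axis j (b j)"
  by (auto simp: corner_def vec_eq_iff axis_def)

text \<open>
  The simplices used below have the vertices \<open>a e\<^sub>j\<close> for \<open>j \<in> J\<close> and \<open>e\<^sub>j\<close> for the other \<open>j\<close>.
\<close>

lemma level_two_valued:
  fixes J :: "'n::finite set"
  shows "level (\<lambda>k. if k \<in> J then a else 1) x = (\<Sum>k\<in>J. x $ k) / a + (\<Sum>k\<in>-J. x $ k)"
proof -
  have "level (\<lambda>k. if k \<in> J then a else 1) x = (\<Sum>k\<in>UNIV. if k \<in> J then x $ k / a else x $ k)"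
    unfolding level_def by (intro sum.cong) auto
  then show ?thesis
    by (simp add: sum.If_cases sum_divide_distrib Compl_eq)
qed

lemma prod_two_valued:
  fixes J :: "'n::finite set" and a :: real
  shows "(\<Prod>k\<in>UNIV. if k \<in> J then a else 1) = a ^ card J"
  by (simp add: prod.If_cases)

lemma corner_two_valued:
  fixes J :: "'n::finite set"
  assumes "j \<in> J" "a \<noteq> 0"
  defines "b \<equiv> \<lambda>k. if k \<in> J then a else 1"
  shows "corner b j y $ j = y $ j + a - (\<Sum>k\<in>J-{j}. y $ k) - a * (\<Sum>k\<in>-J. y $ k)"
    and "(\<Sum>k\<in>J. corner b j y $ k) = y $ j + a - a * (\<Sum>k\<in>-J. y $ k)"
    and "(\<Sum>k\<in>-J. corner b j y $ k) = (\<Sum>k\<in>-J. y $ k)"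
proof -
  have off: "corner b j y $ k = y $ k" if "k \<noteq> j" for k
    using that by (simp add: corner_def)
  show q: "(\<Sum>k\<in>-J. corner b j y $ k) = (\<Sum>k\<in>-J. y $ k)"
    using assms(1) by (intro sum.cong) (auto intro!: off)
  have "b j = a" using assms(1) by (simp add: b_def)
  then have "level b (corner b j y) = 1 + y $ j / a"
    using assms(2) by (simp add: level_corner)
  then show s: "(\<Sum>k\<in>J. corner b j y $ k) = y $ j + a - a * (\<Sum>k\<in>-J. y $ k)"
    unfolding b_def level_two_valued using q assms(2) by (simp add: b_def field_simps)
  have "(\<Sum>k\<in>J. corner b j y $ k) = corner b j y $ j + (\<Sum>k\<in>J-{j}. y $ k)"
    using assms(1) off by (simp add: sum.remove[of J j])
  then show "corner b j y $ j = y $ j + a - (\<Sum>k\<in>J-{j}. y $ k) - a * (\<Sum>k\<in>-J. y $ k)"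
    using s by simp
qed

text \<open>
  Conditions on \<open>y\<close> under which the corresponding point at the vertex \<open>a e\<^sub>j\<close> is admissible: it must
  not cross the hyperplane \<open>x\<^sub>j = 0\<close>, and its height above the facet must not exceed \<open>r - a\<close>.
\<close>

lemma lattice_config_corner:
  fixes J :: "'n::finite set" and a r :: nat
  assumes j: "j \<in> J" and a: "1 \<le> a" "a \<le> r"
    and y: "y \<in> integer_lattice" "0 \<le> y"
    and side: "(\<Sum>k\<in>J-{j}. y $ k) + real a * (\<Sum>k\<in>-J. y $ k) \<le> real a"
    and height: "y $ j + (real r - real a) * (\<Sum>k\<in>-J. y $ k) \<le> real r - real a"
  defines "p \<equiv> corner (\<lambda>k. if k \<in> J then real a else 1) j y"
  shows "p \<in> integer_lattice" "0 \<le> p"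
    "(\<Sum>k\<in>J. p $ k) + real r * (\<Sum>k\<in>-J. p $ k) \<le> real r"
proof -
  have a0: "real a \<noteq> 0" using a by simp
  note c = corner_two_valued[OF j a0, of y, folded p_def]
  have off: "p $ k = y $ k" if "k \<noteq> j" for k
    using that by (simp add: p_def corner_def)
  have "p $ j \<in> \<int>"
    unfolding c using y(1) by (auto simp: integer_lattice_def intro!: Ints_diff Ints_add Ints_mult Ints_sum)
  then show "p \<in> integer_lattice"
    using y(1) off by (auto simp: integer_lattice_def) metis
  have "0 \<le> p $ j"
    unfolding c using side y(2) by (simp add: nonneg_vec_iff add_nonneg_nonneg) (smt (verit))
  then show "0 \<le> p"
    using y(2) off unfolding nonneg_vec_iff by metis
  show "(\<Sum>k\<in>J. p $ k) + real r * (\<Sum>k\<in>-J. p $ k) \<le> real r"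
    unfolding c using height by (simp add: algebra_simps)
qed

text \<open>
  The inductive construction.  The new vertex \<open>a e\<^sub>i\<close> receives the given configuration \<open>N\<close>, which
  contains a point on the \<open>i\<close>-th axis since \<open>i \<notin> I\<close>; an old vertex \<open>a e\<^sub>i\<^sub>'\<close> receives the simplex
  with edges \<open>m\<close> along the facet and height \<open>h\<close>.  Because \<open>a = m + M\<close>, the two corners meet,
  within the coordinates in use, at most in one point of the edge between the two vertices.  This gives
  both compatibility and disjointness.
\<close>

lemma lattice_config_extend:
  fixes I :: "'n::finite set" and m M h r :: nat
  assumes i: "i \<notin> I" and i': "i' \<in> I" and m: "1 \<le> m" and M: "1 \<le> M"
    and r: "m + M + 1 \<le> r" "m + M + h \<le> r"
    and N: "lattice_config I M N"
  shows "\<exists>X. lattice_config (insert i I) r X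
     \<and> covolume X = real (m + M) ^ (card I + 1) + real h * real m ^ card I + covolume N"
proof -
  define J where "J = insert i I"
  define a where "a = m + M"
  define b :: "'n \<Rightarrow> real" where "b = (\<lambda>k. if k \<in> J then real a else 1)"
  define t where "t k = (if k = i' then real h else if k \<in> J then real m else 1)" for k
  define T where "T = range (\<lambda>k. axis k (t k))"
  define Y where "Y j = (if j = i then N else if j = i' then T else {0})" for j
  define X where "X = (\<Union>j. corner b j ` Y j)"
  have ii': "i \<noteq> i'" using i i' by blast
  have J: "i \<in> J" "i' \<in> J" "-I = insert i (-J)" "i \<notin> -J" "J - {i} = I"
    using i i' by (auto simp: J_def)
  have a: "1 \<le> a" "a + 1 \<le> r" "a + h \<le> r" "real a = real m + real M"
    using m r by (simp_all add: a_def)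
  have m0: "0 < real m" and M0: "0 < real M" using m M by simp_all
  have b0: "0 < b k" for k using a by (simp add: b_def)
  have bi: "b i = real a" "b i' = real a" using J by (simp_all add: b_def)
  have N': "finite N" "\<And>y. y \<in> N \<Longrightarrow> y \<in> integer_lattice" "\<And>y. y \<in> N \<Longrightarrow> 0 \<le> y"
    "\<And>y. y \<in> N \<Longrightarrow> (\<Sum>k\<in>I. y $ k) + real M * (y $ i + (\<Sum>k\<in>-J. y $ k)) \<le> real M"
    using N J by (auto simp: lattice_config_def)
  have Nax: "\<exists>s. axis j s \<in> N \<and> 0 \<le> s \<and> s \<le> (if j \<in> I then real M else 1)" for j
    using lattice_config_axisE[OF N M, of j] by metis
  have Nb: "\<exists>s. axis j s \<in> N \<and> s \<le> b j" for j
  proof -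
    obtain s where "axis j s \<in> N" "s \<le> (if j \<in> I then real M else 1)" using Nax by blast
    moreover have "(if j \<in> I then real M else 1) \<le> b j" using a m M by (auto simp: b_def J_def)
    ultimately show ?thesis by (meson order.trans)
  qed
  have t: "0 \<le> t k" "k \<noteq> i' \<Longrightarrow> 0 < t k" "k \<noteq> i' \<Longrightarrow> t k \<le> b k" for k
    using m a by (auto simp: t_def b_def)
  have Tax: "axis k (t k) \<in> T" for k by (auto simp: T_def)
  have q0: "0 \<le> (\<Sum>k\<in>-J. y $ k)" "0 \<le> y $ k" "0 \<le> (\<Sum>k\<in>K. y $ k)" if "0 \<le> y" for y :: "real ^ 'n" and k K
    using that by (simp_all add: nonneg_vec_iff sum_nonneg)
  have Ybounds: "y \<in> integer_lattice" "0 \<le> y"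
      "j \<in> J \<Longrightarrow> (\<Sum>k\<in>J-{j}. y $ k) + real a * (\<Sum>k\<in>-J. y $ k) \<le> real a"
      "j \<in> J \<Longrightarrow> y $ j + (real r - real a) * (\<Sum>k\<in>-J. y $ k) \<le> real r - real a"
    if y: "y \<in> Y j" for y j
  proof -
    have "y \<in> integer_lattice \<and> 0 \<le> y \<and> (j \<in> J \<longrightarrow>
        (\<Sum>k\<in>J-{j}. y $ k) + real a * (\<Sum>k\<in>-J. y $ k) \<le> real a \<and>
        y $ j + (real r - real a) * (\<Sum>k\<in>-J. y $ k) \<le> real r - real a)"
    proof -
      consider "j = i" "y \<in> N" | k where "j = i'" "y = axis k (t k)" | "j \<noteq> i" "j \<noteq> i'" "y = 0"
        using y by (auto simp: Y_def T_def split: if_splits)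
      then show ?thesis
      proof cases
        case 1
        let ?q = "\<Sum>k\<in>-J. y $ k"
        have y0: "0 \<le> y" using N'(3) 1 by blast
        have size: "(\<Sum>k\<in>I. y $ k) + real M * (y $ i + ?q) \<le> real M" using N'(4) 1 by blast
        have "real M * (y $ i + ?q) \<le> real M * 1" using size q0(3)[OF y0, of I] by simp
        then have le1: "y $ i + ?q \<le> 1" using M by (simp del: mult_1_right)
        have "real m * ?q \<le> real m * 1"
          using le1 q0(1)[OF y0] q0(2)[OF y0, of i] by (intro mult_left_mono) auto
        moreover have "0 \<le> real M * y $ i" using q0[OF y0] by simp
        ultimately have A: "(\<Sum>k\<in>I. y $ k) + real a * ?q \<le> real a"
          using size by (simp add: a(4) algebra_simps)
        have "1 * y $ i \<le> (real r - real a) * (1 - ?q)"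
          using le1 a q0(1)[OF y0] q0(2)[OF y0, of i] by (intro mult_mono) auto
        then have "y $ i + (real r - real a) * ?q \<le> real r - real a"
          by (simp add: algebra_simps)
        then show ?thesis using A 1 J N' y0 by simp
      next
        case 2
        have tZ: "t k \<in> \<int>" by (simp add: t_def)
        have "axis k (t k) $ i' = (if k = i' then real h else 0)"
          by (simp add: axis_def t_def)
        moreover have "t k = (if k = i' then real h else if k \<in> J then real m else 1)"
          by (simp add: t_def)
        moreover have "real m \<le> real a" "real h \<le> real r - real a" "0 \<le> real r - real a"
          using a by linarith+
        ultimately have "(\<Sum>l\<in>J-{i'}. axis k (t k) $ l) + real a * (\<Sum>l\<in>-J. axis k (t k) $ l) \<le> real a"
          "axis k (t k) $ i' + (real r - real a) * (\<Sum>l\<in>-J. axis k (t k) $ l) \<le> real r - real a"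
          unfolding sum_axis using J(2) by (cases "k = i'"; cases "k \<in> J"; simp)+
        then show ?thesis
          unfolding 2 using axis_in_integer_lattice[OF tZ] t(1)[of k] nonneg_axis_iff by blast
      qed (use a in \<open>auto simp: integer_lattice_def\<close>)
    qed
    then show "y \<in> integer_lattice" "0 \<le> y"
      "j \<in> J \<Longrightarrow> (\<Sum>k\<in>J-{j}. y $ k) + real a * (\<Sum>k\<in>-J. y $ k) \<le> real a"
      "j \<in> J \<Longrightarrow> y $ j + (real r - real a) * (\<Sum>k\<in>-J. y $ k) \<le> real r - real a"
      by blast+
  qed
  have points: "corner b j y \<in> integer_lattice \<and> 0 \<le> corner b j y \<and>
      (\<Sum>k\<in>J. corner b j y $ k) + real r * (\<Sum>k\<in>-J. corner b j y $ k) \<le> real r"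
    if y: "y \<in> Y j" for j y
  proof (cases "j \<in> J")
    case True
    then show ?thesis
      using lattice_config_corner[OF True a(1) _ Ybounds(1,2)[OF y] Ybounds(3,4)[OF y True]] a(2)
      unfolding b_def by simp
  next
    case False
    then have "corner b j y = axis j 1"
      using y J by (auto simp: Y_def corner_zero b_def split: if_splits)
    then show ?thesis using False by (simp add: axis_in_integer_lattice nonneg_axis_iff sum_axis)
  qed
  have config: "lattice_config J r X"
    unfolding lattice_config_def
  proof (intro conjI allI)
    show "finite X" using N'(1) by (auto simp: X_def Y_def T_def)
    show "\<forall>x\<in>X. x \<in> integer_lattice \<and> 0 \<le> x \<and> (\<Sum>k\<in>J. x $ k) + real r * (\<Sum>k\<in>-J. x $ k) \<le> real r"
      using points by (auto simp: X_def)
    fix j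
    have "\<exists>s. axis j s \<in> Y j"
      using Nax[of j] Tax[of j] by (auto simp: Y_def intro: exI[of _ 0])
    then show "\<exists>s. axis j s \<in> X"
      unfolding X_def using corner_axis[of b j] by (metis UNIV_I UN_I imageI)
  qed
  have straight0: "0 \<le> straighten b k (corner b j y)" if y: "y \<in> Y j" "k \<noteq> j" for k j y
  proof -
    have "0 \<le> straighten b k (corner b j y) $ l" for l
      using points[OF y(1)] Ybounds(2)[OF y(1)] b0[of k] b0[of j] b0[of j, THEN less_imp_neq, THEN not_sym]
      by (auto simp: straighten_def level_corner nonneg_vec_iff)
    then show ?thesis by (simp add: nonneg_vec_iff)
  qed
  have compat: "straighten b k (corner b j y) \<in> newton_polyhedron (Y k)"
    if y: "y \<in> Y j" and kj: "k \<noteq> j" for k j y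
  proof -
    let ?p = "corner b j y"
    let ?z = "straighten b k ?p"
    have zp: "?z $ l = ?p $ l" if "l \<noteq> k" for l using that by (simp add: straighten_def)
    note z0 = straight0[OF y kj]
    \<comment> \<open>Only the pair of the two nontrivial corners needs an estimate.  Apart from the unit vectors on
        the unused axes, a point of the simplex at \<open>i'\<close> has \<open>i'\<close>-th coordinate at least \<open>a - m = M\<close>
        and so lies beyond the axis point of \<open>N\<close>, and a point of the corner at \<open>i\<close> has
        \<open>i'\<close>-th coordinate at most \<open>M\<close>, hence its other coordinates sum to at least \<open>m\<close>.\<close>
    consider "k \<noteq> i" "k \<noteq> i'" | "k = i" "j = i'" | "k = i'" "j = i"
      | "k = i \<or> k = i'" "j \<noteq> i" "j \<noteq> i'" using kj by blast
    then show ?thesis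
    proof cases
      case 1
      then show ?thesis by (simp add: Y_def newton_polyhedron_zero)
    next
      case 2
      then obtain l where l: "y = axis l (t l)" using y ii' by (auto simp: Y_def T_def)
      show ?thesis
      proof (cases "l \<in> J")
        case True
        have "real a - real m \<le> ?p $ i'"
          unfolding 2 b_def using corner_two_valued(1)[OF J(2), of "real a" y] a True
          by (auto simp: l sum_axis) (auto simp: axis_def t_def)
        then have "real M \<le> ?z $ i'" using zp[of i'] 2 ii' a by simp
        moreover obtain s where "axis i' s \<in> N" "s \<le> real M" using Nax[of i'] i' by auto
        ultimately show ?thesis
          using newton_polyhedron_above_axis[OF _ _ z0, of i' s] 2 by (simp add: Y_def)
      next
        case False
        then have "l \<noteq> i" "l \<noteq> i'" "l \<notin> I" using J by auto
        then have "?z $ l = 1" using zp[of l] 2 False by (simp add: corner_def l t_def axis_def)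
        moreover obtain s where "axis l s \<in> N" "s \<le> 1" using Nax[of l] \<open>l \<notin> I\<close> by auto
        ultimately show ?thesis
          using newton_polyhedron_above_axis[OF _ _ z0, of l s] 2 by (simp add: Y_def)
      qed
    next
      case 3
      let ?q = "\<Sum>k\<in>-J. y $ k"
      have yN: "y \<in> N" using y 3 by (simp add: Y_def)
      have y0: "0 \<le> y" and size: "(\<Sum>k\<in>I. y $ k) + real M * (y $ i + ?q) \<le> real M"
        using N' yN by blast+
      have "y $ i' \<le> (\<Sum>k\<in>I. y $ k)" using i' q0[OF y0] by (intro member_le_sum) auto
      moreover have "?p $ i' = y $ i'" using 3 ii' by (simp add: corner_def)
      moreover have "(\<Sum>l\<in>J. ?p $ l) = ?p $ i' + (\<Sum>l\<in>J-{i'}. ?p $ l)"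
        using J by (intro sum.remove) auto
      moreover have "(\<Sum>l\<in>J. ?p $ l) = y $ i + real a - real a * ?q"
        unfolding 3 b_def using corner_two_valued(2)[OF J(1)] a by simp
      moreover have "0 \<le> real M * y $ i" "0 \<le> y $ i" using q0(2)[OF y0] by simp_all
      moreover have "(\<Sum>k\<in>I. y $ k) + (real M * y $ i + real M * ?q) \<le> real M"
        using size by (simp only: distrib_left)
      moreover have "real a * ?q = real m * ?q + real M * ?q"
        by (simp only: a(4) distrib_right)
      ultimately have "real m - real m * ?q \<le> (\<Sum>l\<in>J-{i'}. ?p $ l)"
        using a(4) by linarith
      then have "real m * (1 - ?q) \<le> (\<Sum>l\<in>J-{i'}. ?p $ l)"
        by (simp only: right_diff_distrib mult_1_right)
      then have "1 - ?q \<le> (\<Sum>l\<in>J-{i'}. ?p $ l) / real m"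
        using m by (simp add: pos_le_divide_eq mult.commute)
      moreover have "(\<Sum>l\<in>-J. ?p $ l) = ?q"
        unfolding 3 b_def using corner_two_valued(3)[OF J(1)] a by simp
      moreover have zp3: "?z $ l = ?p $ l" if "l \<noteq> i'" for l using zp[of l] that 3(1) by metis
      moreover have "(\<Sum>l\<in>-{i'}. ?z $ l / t l) = (\<Sum>l\<in>J-{i'}. ?p $ l) / real m + (\<Sum>l\<in>-J. ?p $ l)"
      proof -
        have "-{i'} = (J - {i'}) \<union> -J" using J by auto
        then have "(\<Sum>l\<in>-{i'}. ?z $ l / t l) = (\<Sum>l\<in>J-{i'}. ?z $ l / t l) + (\<Sum>l\<in>-J. ?z $ l / t l)"
          by (simp only:) (rule sum.union_disjoint, auto)
        also have "(\<Sum>l\<in>J-{i'}. ?z $ l / t l) = (\<Sum>l\<in>J-{i'}. ?p $ l) / real m"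
          unfolding sum_divide_distrib by (rule sum.cong) (simp_all add: zp3 t_def)
        also have "(\<Sum>l\<in>-J. ?z $ l / t l) = (\<Sum>l\<in>-J. ?p $ l)"
        proof (rule sum.cong)
          fix l assume "l \<in> -J"
          then have "l \<noteq> i'" "l \<notin> J" using J(2) by auto
          then show "?z $ l / t l = ?p $ l" by (simp add: zp3 t_def)
        qed simp
        finally show ?thesis .
      qed
      ultimately have "1 \<le> (\<Sum>l\<in>-{i'}. ?z $ l / t l)" by linarith
      then have "?z \<in> newton_polyhedron T"
        using t Tax by (intro newton_polyhedron_above_axes[OF _ z0]) auto
      then show ?thesis using 3 ii' by (simp add: Y_def)
    next
      case 4
      then have "?p = axis j (b j)" using y by (simp add: Y_def corner_zero)
      then have zj: "?z $ j = b j" using zp[of j] kj by simp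
      have "\<exists>s\<le>b j. axis j s \<in> Y k"
      proof (cases "k = i")
        case True
        then have "Y k = N" by (simp add: Y_def)
        then show ?thesis using Nb[of j] by blast
      next
        case False
        then have "Y k = T" using 4 by (simp add: Y_def)
        then show ?thesis using 4 Tax[of j] t(3)[of j] by blast
      qed
      then show ?thesis using newton_polyhedron_above_axis[OF _ _ z0, of j] zj by metis
    qed
  qed
  have axes: "\<exists>s. axis j s \<in> Y k \<and> (j \<noteq> k \<longrightarrow> s \<le> b j)" for k j
  proof -
    consider "k = i" | "k = i'" | "k \<noteq> i" "k \<noteq> i'" by blast
    then show ?thesis
    proof cases
      case 1
      then have "Y k = N" by (simp add: Y_def)
      then show ?thesis using Nb[of j] by blast
    next
      case 2
      then have "Y k = T" using ii' by (simp add: Y_def)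
      then show ?thesis using 2 Tax[of j] t(3)[of j] by blast
    next
      case 3
      then have "Y k = {axis j 0}" by (simp add: Y_def)
      then show ?thesis using b0[of j] by (intro exI[of _ 0]) simp
    qed
  qed
  \<comment> \<open>Let \<open>q\<close> be the sum of the unused coordinates.  Among the others, those different from \<open>x\<^sub>i\<close> sum to
      less than \<open>M (1 - q)\<close> below the first corner, and those different from \<open>x\<^sub>i\<^sub>'\<close> to less than \<open>m (1 - q)\<close>
      below the second one; so a common point would be below the outer facet.\<close>
  have disj_main: False if x: "0 \<le> x" "1 \<le> level b x"
    and xi: "straighten b i x \<in> under N" and xi': "straighten b i' x \<in> under T" for x
  proof -
    let ?q = "\<Sum>k\<in>-J. x $ k"
    have pos: "0 \<le> straighten b i x $ i" "0 \<le> straighten b i' x $ i'"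
      using xi xi' by (auto simp: under_def nonneg_vec_iff)
    have "\<exists>s\<le>(if j \<in> I then real M else 1). axis j s \<in> N" for j using Nax[of j] by auto
    from under_below_axes[OF xi this]
    have "(\<Sum>k\<in>UNIV. straighten b i x $ k / (if k \<in> I then real M else 1)) < 1" .
    then have "(\<Sum>k\<in>I. straighten b i x $ k) / real M + (\<Sum>k\<in>-I. straighten b i x $ k) < 1"
      unfolding level_two_valued[symmetric] level_def .
    moreover have "(\<Sum>k\<in>I. straighten b i x $ k) = (\<Sum>k\<in>I. x $ k)"
      using i by (intro sum.cong) (auto simp: straighten_def)
    moreover have "(\<Sum>k\<in>-I. straighten b i x $ k) = straighten b i x $ i + ?q"
    proof -
      have "(\<Sum>k\<in>-I. straighten b i x $ k)
          = straighten b i x $ i + (\<Sum>k\<in>-J. straighten b i x $ k)"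
        unfolding J(3) using J(4) by (intro sum.insert) auto
      moreover have "(\<Sum>k\<in>-J. straighten b i x $ k) = ?q"
      proof (rule sum.cong)
        fix k assume "k \<in> -J"
        then have "k \<noteq> i" using J(4) by metis
        then show "straighten b i x $ k = x $ k" by (simp add: straighten_def)
      qed simp
      ultimately show ?thesis by simp
    qed
    ultimately have "(\<Sum>k\<in>I. x $ k) / real M + (straighten b i x $ i + ?q) < 1"
      by (simp only:)
    then have "(\<Sum>k\<in>I. x $ k) / real M + ?q < 1"
      using pos(1) by linarith
    then have "(\<Sum>k\<in>I. x $ k) / real M < 1 - ?q" by linarith
    then have 1: "(\<Sum>k\<in>I. x $ k) < (1 - ?q) * real M"
      using M0 by (simp only: pos_divide_less_eq)
    have "\<exists>s\<le>(t(i' := max (real h) 1)) k. axis k s \<in> T" for k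
    proof -
      have "t k \<le> (t(i' := max (real h) 1)) k" by (simp add: t_def)
      then show ?thesis using Tax[of k] by blast
    qed
    from under_below_axes[OF xi' this]
    have "(\<Sum>k\<in>UNIV. straighten b i' x $ k / (t(i' := max (real h) 1)) k) < 1" .
    then have "(\<Sum>k\<in>-{i'}. straighten b i' x $ k / (t(i' := max (real h) 1)) k) < 1"
      using pos(2) divide_nonneg_pos[OF pos(2), of "max (real h) 1"]
      unfolding sum_UNIV_remove[of _ i'] fun_upd_same by linarith
    moreover have "(\<Sum>k\<in>-{i'}. straighten b i' x $ k / (t(i' := max (real h) 1)) k)
        = (\<Sum>k\<in>J-{i'}. x $ k) / real m + ?q"
    proof -
      have "(\<Sum>k\<in>-{i'}. straighten b i' x $ k / (t(i' := max (real h) 1)) k)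
          = (\<Sum>k\<in>(J-{i'}) \<union> -J. if k \<in> J then x $ k / real m else x $ k)"
        using J(2) by (intro sum.cong) (auto simp: straighten_def t_def)
      also have "\<dots> = (\<Sum>k\<in>J-{i'}. if k \<in> J then x $ k / real m else x $ k)
          + (\<Sum>k\<in>-J. if k \<in> J then x $ k / real m else x $ k)"
        by (rule sum.union_disjoint) auto
      also have "\<dots> = (\<Sum>k\<in>J-{i'}. x $ k / real m) + ?q" by simp
      finally show ?thesis by (simp add: sum_divide_distrib)
    qed
    ultimately have "(\<Sum>k\<in>J-{i'}. x $ k) / real m < 1 - ?q" by linarith
    then have 2: "(\<Sum>k\<in>J-{i'}. x $ k) < (1 - ?q) * real m"
      using m0 by (simp only: pos_divide_less_eq)
    have "x $ i \<le> (\<Sum>k\<in>J-{i'}. x $ k)"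
      using J ii' q0[OF x(1)] by (intro member_le_sum) auto
    moreover have "(\<Sum>k\<in>J. x $ k) = x $ i + (\<Sum>k\<in>I. x $ k)"
      using i by (simp add: J_def)
    moreover have "real a * (1 - ?q) \<le> (\<Sum>k\<in>J. x $ k)"
      using x(2) a(1) unfolding b_def level_two_valued by (simp add: field_simps)
    ultimately show False
      using 1 2 a(4) by (simp add: algebra_simps)
  qed
  have under0: "under {0 :: real ^ 'n} = {}" by (simp add: under_def newton_polyhedron_zero)
  have "covolume X = prod b UNIV + (\<Sum>j\<in>UNIV. covolume (Y j))"
    unfolding X_def
  proof (rule covolume_corners[OF b0 _ compat axes])
    show "0 \<le> y $ j" if "y \<in> Y j" for j y
      using Ybounds(2)[OF that] by (simp add: nonneg_vec_iff)
    show False if "k \<noteq> j" "0 \<le> x" "1 \<le> level b x" "straighten b k x \<in> under (Y k)"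
      "straighten b j x \<in> under (Y j)" for k j x
      using that disj_main[of x] ii' by (auto simp: Y_def under0 split: if_splits)
  qed
  moreover have "prod b UNIV = real a ^ (card I + 1)"
    unfolding b_def prod_two_valued using i by (simp add: J_def)
  moreover have "(\<Sum>j\<in>UNIV. covolume (Y j)) = (\<Sum>j\<in>{i, i'}. covolume (Y j))"
    by (rule sum.mono_neutral_right) (auto simp: Y_def covolume_def under0)
  moreover have "covolume T = real h * real m ^ card I"
  proof -
    have "covolume T = prod t UNIV" unfolding T_def by (rule covolume_axes) (rule t)
    also have "\<dots> = t i' * (\<Prod>k\<in>UNIV-{i'}. t k)" by (intro prod.remove) auto
    also have "(\<Prod>k\<in>UNIV-{i'}. t k) = (\<Prod>k\<in>UNIV. if k \<in> J - {i'} then real m else 1)"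
      by (intro prod.mono_neutral_cong_left) (auto simp: t_def)
    also have "\<dots> = real m ^ card I"
      unfolding prod_two_valued using i i' ii' by (simp add: J_def card_insert_if)
    finally show ?thesis by (simp add: t_def)
  qed
  ultimately have "covolume X = real (m + M) ^ (card I + 1) + real h * real m ^ card I + covolume N"
    using ii' by (simp add: Y_def a_def)
  then show ?thesis using config unfolding J_def by blast
qed

section \<open>Realizing all covolumes\<close>

text \<open>
  The mean value estimate for the power function, in a form without subtraction.
\<close>

lemma power_add_le: "(x + d) ^ Suc n \<le> x ^ Suc n + Suc n * d * (x + d) ^ n" for x d n :: nat
proof (induction n)
  case (Suc n)
  have "(x + d) ^ Suc (Suc n) = x * (x + d) ^ Suc n + d * (x + d) ^ Suc n"
    by (simp add: algebra_simps)
  also have "\<dots> \<le> x * (x ^ Suc n + Suc n * d * (x + d) ^ n) + d * (x + d) ^ Suc n"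
    using Suc.IH by (intro add_right_mono mult_left_mono) auto
  also have "\<dots> = x ^ Suc (Suc n) + Suc n * d * (x * (x + d) ^ n) + d * (x + d) ^ Suc n"
    by (simp add: algebra_simps)
  also have "\<dots> \<le> x ^ Suc (Suc n) + Suc n * d * ((x + d) * (x + d) ^ n) + d * (x + d) ^ Suc n"
    by (intro add_right_mono add_left_mono mult_left_mono mult_right_mono) auto
  also have "\<dots> = x ^ Suc (Suc n) + Suc (Suc n) * d * (x + d) ^ Suc n"
    by (simp add: algebra_simps)
  finally show ?case .
qed simp

text \<open>
  Simplices with one edge of length \<open>u\<close> and unit edges otherwise.  They start the induction and
  supply the values of \<open>u\<close> that are too small for the corner construction.
\<close>

lemma lattice_config_small:
  fixes I :: "'n::finite set"
  assumes "i \<in> I" "u \<le> r" "1 \<le> r"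
  shows "\<exists>X. lattice_config I r X \<and> covolume X = real u"
proof -
  let ?t = "\<lambda>j. if j = i then u else 1"
  have "lattice_config I r (range (\<lambda>j. axis j (real (?t j))))"
    using assms by (intro lattice_config_axes) auto
  moreover have "covolume (range (\<lambda>j. axis j (real (?t j)))) = (\<Prod>j\<in>UNIV. real (?t j))"
    by (rule covolume_axes) simp
  moreover have "(\<Prod>j\<in>UNIV. real (?t j)) = real u"
    using prod.delta[of UNIV i "\<lambda>_. real u"] by (simp add: if_distrib cong: if_cong)
  ultimately show ?thesis by metis
qed

text \<open>
  Choice of the parameters.  The constant \<open>C'\<close> must be so large that \<open>r < u\<close> forces \<open>m \<ge> 1\<close>, whence the
  summand \<open>(C + 2) ^ Suc k\<close>, and that the bound \<open>u + C' r\<^sup>k \<le> r\<^bsup>k+1\<^esup>\<close> leaves room for the height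
  \<open>h \<le> H\<close> above the simplex of size \<open>a\<close>, whence the summand \<open>Suc k * (H + 1)\<close>.
\<close>

lemma lattice_config_exists:
  fixes I :: "'n::finite set"
  assumes "I \<noteq> {}"
  shows "\<exists>C. \<forall>r\<ge>1. \<forall>u. u + C * r ^ (card I - 1) \<le> r ^ card I
           \<longrightarrow> (\<exists>X. lattice_config I r X \<and> covolume X = real u)"
  using finite[of I] assms
proof (induction I rule: finite_ne_induct)
  case (singleton i)
  then show ?case using lattice_config_small[of i "{i}"] by (intro exI[of _ 0]) auto
next
  case (insert i F)
  define k where "k = card F"
  obtain C where C: "\<And>r u. 1 \<le> r \<Longrightarrow> u + C * r ^ (k - 1) \<le> r ^ k
      \<Longrightarrow> \<exists>X. lattice_config F r X \<and> covolume X = real u"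
    using insert.IH unfolding k_def by blast
  have k: "1 \<le> k" using insert.hyps by (simp add: k_def Suc_le_eq card_gt_0_iff)
  have card: "card (insert i F) = Suc k" using insert.hyps by (simp add: k_def)
  obtain i' where i': "i' \<in> F" using insert.hyps by blast
  define H where "H = Suc k * 2 * (C + 4) ^ k"
  define C' where "C' = (C + 2) ^ Suc k + Suc k * (H + 1) + 1"
  have "\<exists>X. lattice_config (insert i F) r X \<and> covolume X = real u"
    if r: "1 \<le> r" and u: "u + C' * r ^ k \<le> r ^ Suc k" for r u
  proof (cases "u \<le> r")
    case True
    then show ?thesis using r by (intro lattice_config_small[of i]) auto
  next
    case False
    have "C' * r ^ k \<le> r * r ^ k" using u unfolding power_Suc by linarith
    then have C'r: "C' \<le> r" using r by simp
    have "(C + 2) ^ Suc k \<le> C'" by (simp add: C'_def)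
    then have big: "(C + 2) ^ Suc k \<le> u" using C'r False by linarith
    \<comment> \<open>The least \<open>n\<close> with \<open>u < (2 (n + 1) + C) ^ Suc k\<close> is the largest \<open>m\<close> with \<open>(2 m + C) ^ Suc k \<le> u\<close>.\<close>
    define m where "m = (LEAST n. u < (2 * n + 2 + C) ^ Suc k)"
    have "u < 2 * u + 2 + C" by simp
    also have "\<dots> \<le> (2 * u + 2 + C) ^ Suc k" by (rule self_le_power) auto
    finally have m_less: "u < (2 * m + 2 + C) ^ Suc k"
      unfolding m_def by (rule LeastI[of "\<lambda>n. u < (2 * n + 2 + C) ^ Suc k"])
    have m: "1 \<le> m"
    proof (rule ccontr)
      assume "\<not> 1 \<le> m"
      then have "2 * m + 2 + C = C + 2" by simp
      then have "u < (C + 2) ^ Suc k" using m_less by metis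
      then show False using big by linarith
    qed
    have "\<not> u < (2 * (m - 1) + 2 + C) ^ Suc k"
      using m unfolding m_def by (intro not_less_Least) simp
    moreover have "2 * (m - 1) + 2 + C = 2 * m + C" using m by simp
    ultimately have m_ge: "(2 * m + C) ^ Suc k \<le> u" by (metis not_less)
    define M where "M = m + C"
    define a where "a = m + M"
    have a: "a = 2 * m + C" by (simp add: a_def M_def)
    define e where "e = u - a ^ Suc k"
    define h where "h = e div m ^ k"
    define w where "w = e mod m ^ k"
    have ue: "u = a ^ Suc k + h * m ^ k + w"
    proof -
      have "u = a ^ Suc k + e" using m_ge unfolding e_def a by linarith
      moreover have "e = h * m ^ k + w" by (simp only: h_def w_def div_mult_mod_eq)
      ultimately show ?thesis by linarith
    qed
    have "h \<le> H"
    proof -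
      have "e \<le> (a + 2) ^ Suc k - a ^ Suc k"
      proof -
        have "2 * m + 2 + C = a + 2" by (simp add: a)
        then have "u < (a + 2) ^ Suc k" using m_less by metis
        then show ?thesis unfolding e_def by linarith
      qed
      also have "\<dots> \<le> Suc k * 2 * (a + 2) ^ k"
        using power_add_le[of a 2 k] by linarith
      also have "\<dots> \<le> Suc k * 2 * ((C + 4) * m) ^ k"
      proof -
        have "C \<le> C * m" using m by simp
        then have "a + 2 \<le> (C + 4) * m" using m unfolding a distrib_right by linarith
        then show ?thesis by (intro mult_left_mono power_mono) auto
      qed
      also have "\<dots> = H * m ^ k" by (simp only: H_def power_mult_distrib mult.assoc)
      finally have "h * m ^ k \<le> H * m ^ k"
        unfolding h_def using order.trans[OF div_times_less_eq_dividend] by blast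
      then show ?thesis using m by simp
    qed
    have "a + (H + 1) \<le> r"
    proof (rule ccontr)
      assume "\<not> a + (H + 1) \<le> r"
      have "1 * (H + 1) \<le> Suc k * (H + 1)" by (intro mult_right_mono) auto
      then have Hr: "H + 1 \<le> r" using C'r by (simp add: C'_def)
      then have "r ^ Suc k \<le> (r - (H + 1)) ^ Suc k + Suc k * (H + 1) * r ^ k"
        using power_add_le[of "r - (H + 1)" "H + 1" k] by (simp only: le_add_diff_inverse2)
      moreover have "(r - (H + 1)) ^ Suc k \<le> a ^ Suc k"
        using \<open>\<not> a + (H + 1) \<le> r\<close> by (intro power_mono) auto
      moreover have "a ^ Suc k \<le> u" using m_ge unfolding a .
      moreover have "Suc k * (H + 1) * r ^ k < C' * r ^ k"
      proof (rule mult_strict_right_mono)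
        show "Suc k * (H + 1) < C'" unfolding C'_def by linarith
      qed (use r in simp)
      ultimately show False using u by linarith
    qed
    then have ar: "m + M + 1 \<le> r" "m + M + h \<le> r"
      using \<open>h \<le> H\<close> by (simp_all add: a_def)
    have "w + C * M ^ (k - 1) \<le> M ^ k"
    proof -
      have pow: "x ^ k = x ^ (k - 1) * x" for x :: nat
        using k by (simp add: power_eq_if)
      have "w < m ^ k" using m by (simp add: w_def)
      also have "m ^ k \<le> M ^ (k - 1) * m"
        unfolding pow by (intro mult_right_mono power_mono) (auto simp: M_def)
      finally show ?thesis unfolding pow[of M] by (simp add: M_def algebra_simps)
    qed
    moreover have M: "1 \<le> M" using m by (simp add: M_def)
    ultimately obtain N where N: "lattice_config F M N" "covolume N = real w" using C by blast
    have "\<exists>X. lattice_config (insert i F) r X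
        \<and> covolume X = real (m + M) ^ (card F + 1) + real h * real m ^ card F + covolume N"
      by (rule lattice_config_extend[OF insert.hyps(3) i' m M ar N(1)])
    moreover have "real (m + M) ^ (card F + 1) + real h * real m ^ card F + covolume N = real u"
      unfolding ue N(2) by (simp add: a_def k_def)
    ultimately show ?thesis by simp
  qed
  then show ?case unfolding card by (intro exI[of _ C']) simp
qed

section \<open>From configurations to polytopes\<close>

lemma simplex_full_scaled:
  "simplex_full r = (*\<^sub>R) (real r) ` (convex hull (insert 0 Basis) :: (real ^ 'n) set)"
proof -
  have B: "(Basis :: (real^'n) set) = range (\<lambda>j. axis j 1)"
    by (auto simp: Basis_vec_def)
  have "insert 0 (range (\<lambda>j::'n. real r *\<^sub>R axis j (1::real))) = (*\<^sub>R) (real r) ` insert 0 Basis"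
    by (simp add: B image_image)
  then show ?thesis
    unfolding simplex_full_def simplex_face_def hull_Un_left[symmetric]
    by (simp only: convex_hull_scaling Un_insert_right Un_empty_right)
qed

lemma simplex_full_eq:
  assumes "1 \<le> r"
  shows "simplex_full r = {x :: real ^ 'n. 0 \<le> x \<and> (\<Sum>j\<in>UNIV. x $ j) \<le> real r}" (is "_ = ?R")
proof (intro equalityI subsetI)
  fix x :: "real ^ 'n" assume "x \<in> simplex_full r"
  then show "x \<in> ?R"
    using mult_left_mono[of "\<Sum>j\<in>UNIV. y $ j" 1 "real r" for y :: "real ^ 'n"]
    by (auto simp: simplex_full_scaled std_simplex_cart nonneg_vec_iff sum_distrib_left[symmetric])
next
  fix x :: "real ^ 'n" assume x: "x \<in> ?R"
  have "x = real r *\<^sub>R (x /\<^sub>R real r)" using assms by simp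
  moreover have "(\<Sum>j\<in>UNIV. (x /\<^sub>R real r) $ j) = (\<Sum>j\<in>UNIV. x $ j) / real r"
    by (simp add: sum_distrib_left divide_inverse_commute)
  then have "x /\<^sub>R real r \<in> convex hull (insert 0 Basis)"
    using x assms unfolding std_simplex_cart by (auto simp: nonneg_vec_iff)
  ultimately show "x \<in> simplex_full r" unfolding simplex_full_scaled by (rule image_eqI)
qed

lemma measure_simplex_full:
  "(simplex_full r :: (real ^ 'n) set) \<in> lmeasurable"
  "measure lebesgue (simplex_full r :: (real ^ 'n) set) = real r ^ CARD('n) / fact CARD('n)"
proof -
  let ?S = "{x :: real ^ 'n. 0 \<le> x \<and> (\<Sum>j\<in>UNIV. x $ j) \<le> 1}"
  have S: "?S \<in> lmeasurable" "measure lebesgue ?S = 1 / fact CARD('n)"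
    by (rule measure_std_simplex_cart; simp)+
  have "simplex_full r = (\<lambda>x. \<chi> k. real r * x $ k) ` ?S"
    unfolding simplex_full_scaled std_simplex_cart by (intro image_cong) (auto simp: vec_eq_iff)
  then show "(simplex_full r :: (real ^ 'n) set) \<in> lmeasurable"
    "measure lebesgue (simplex_full r :: (real ^ 'n) set) = real r ^ CARD('n) / fact CARD('n)"
    using measurable_stretch[OF S(1), of "\<lambda>_. real r"] measure_stretch[OF S(1), of "\<lambda>_. real r"] S(2)
    by simp_all
qed

lemma under_subset_simplex_full:
  fixes X :: "(real ^ 'n) set"
  assumes X: "lattice_config UNIV r X" and r: "1 \<le> r"
  shows "under X \<subseteq> simplex_full r"
proof
  fix x assume x: "x \<in> under X"
  have "\<exists>s\<le>real r. axis j s \<in> X" for j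
    using lattice_config_axisE[OF X r, of j] by auto
  from under_below_axes[OF x this]
  have "(\<Sum>j\<in>UNIV. x $ j) / real r < 1" by (simp add: sum_divide_distrib)
  then show "x \<in> simplex_full r"
    using x r by (simp add: simplex_full_eq under_def)
qed

text \<open>
  A point of \<open>S(r)\<close> outside the hull is separated from it by some functional \<open>w\<close>.  If the smallest
  coefficient of \<open>w\<close> were negative, then \<open>w\<close> would be minimal on \<open>S(r)\<close> at a vertex \<open>r e\<^sub>i\<close>, which belongs
  to the hull.  So \<open>w\<close> is nonnegative and witnesses that the point is below the Newton polyhedron.
\<close>

lemma convex_hull_lattice_config:
  fixes X :: "(real ^ 'n) set"
  assumes X: "lattice_config UNIV r X" and r: "1 \<le> r"
  shows "convex hull (X \<union> range (\<lambda>j. axis j (real r))) = simplex_full r - under X"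
proof (intro equalityI subsetI)
  let ?V = "X \<union> range (\<lambda>j. axis j (real r))"
  have X': "0 \<le> x \<and> (\<Sum>j\<in>UNIV. x $ j) \<le> real r" if "x \<in> X" for x
    using X that by (auto simp: lattice_config_def)
  {
    fix x assume x: "x \<in> convex hull ?V"
    have "?V \<subseteq> simplex_full r"
      using X' by (auto simp: simplex_full_eq[OF r] nonneg_axis_iff sum_axis)
    moreover have "convex (simplex_full r :: (real ^ 'n) set)" by (simp add: simplex_full_def)
    ultimately have "x \<in> simplex_full r" using x hull_minimal[of ?V "simplex_full r" convex] by blast
    moreover have "?V \<subseteq> newton_polyhedron X"
    proof -
      have "axis j (real r) \<in> newton_polyhedron X" for j
      proof -
        obtain s where "axis j s \<in> X" "s \<le> (if j \<in> UNIV then real r else 1)"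
          using lattice_config_axisE[OF X r] by metis
        then show ?thesis by (intro newton_polyhedron_above_axis[of j s]) (auto simp: nonneg_axis_iff)
      qed
      then show ?thesis by (auto intro: subset_newton_polyhedron)
    qed
    then have "x \<in> newton_polyhedron X"
      using x hull_minimal[of ?V "newton_polyhedron X" convex] convex_newton_polyhedron by blast
    ultimately show "x \<in> simplex_full r - under X" by (simp add: under_def)
  next
    fix x assume x: "x \<in> simplex_full r - under X"
    then have x0: "0 \<le> x" "(\<Sum>j\<in>UNIV. x $ j) \<le> real r" by (auto simp: simplex_full_eq[OF r])
    show "x \<in> convex hull ?V"
    proof (rule ccontr)
      assume "x \<notin> convex hull ?V"
      moreover have "closed (convex hull ?V)"
        using X by (intro compact_imp_closed finite_imp_compact_convex_hull)
          (auto simp: lattice_config_def)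
      ultimately obtain w c where w: "w \<bullet> x < c" "\<And>p. p \<in> convex hull ?V \<Longrightarrow> c < w \<bullet> p"
        using separating_hyperplane_closed_point[OF convex_convex_hull] by metis
      have wV: "c < w \<bullet> p" if "p \<in> ?V" for p using w(2) hull_subset[of ?V convex] that by blast
      have wr: "c < w $ j * real r" for j using wV[of "axis j (real r)"] by (simp add: inner_axis)
      obtain i where i: "\<And>j. w $ i \<le> w $ j"
        using ex_is_arg_min_if_finite[of UNIV "\<lambda>j. w $ j"] by (auto simp: is_arg_min_linorder)
      have low: "w $ i * (\<Sum>j\<in>UNIV. x $ j) \<le> w \<bullet> x"
        unfolding inner_vec_sum sum_distrib_left
        using i x0(1) by (intro sum_mono mult_right_mono) (auto simp: nonneg_vec_iff)
      have "0 \<le> w $ i"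
      proof (rule ccontr)
        assume "\<not> 0 \<le> w $ i"
        then have "w $ i * real r \<le> w $ i * (\<Sum>j\<in>UNIV. x $ j)"
          using x0(2) by (intro mult_left_mono_neg) auto
        then show False using low wr[of i] w(1) by linarith
      qed
      then have w0: "0 \<le> w" using i unfolding nonneg_vec_iff by (meson order.trans)
      have "0 \<le> w \<bullet> x"
        unfolding inner_vec_sum using w0 x0 by (intro sum_nonneg) (auto simp: nonneg_vec_iff)
      then have c: "0 < c" using w(1) by linarith
      have "x \<in> under X"
      proof (rule underI[OF x0(1), where w = "w /\<^sub>R c"])
        show "0 \<le> w /\<^sub>R c" using w0 c by (simp add: nonneg_vec_iff)
        show "1 \<le> (w /\<^sub>R c) \<bullet> p" if "p \<in> X" for p
          using wV[of p] that c by (simp add: field_simps)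
        show "(w /\<^sub>R c) \<bullet> x < 1" using w(1) c by (simp add: field_simps)
      qed
      then show False using x by simp
    qed
  }
qed

theorem theorem1p1:
  assumes "CARD('n::finite) \<ge> 2"
  shows "\<exists>c::real. c > 0 \<and>
    (\<forall>r::nat. r \<ge> 1 \<longrightarrow>
      (\<forall>v::int. c * real r ^ (CARD('n) - 1) \<le> real_of_int v \<and>
                 real_of_int v \<le> real r ^ CARD('n) \<longrightarrow>
        (\<exists>P \<in> (lattice_polytopes_between r :: (real ^ 'n) set set).
           normalized_volume P = real_of_int v)))"
proof -
  obtain C where C: "\<And>r u. 1 \<le> r \<Longrightarrow> u + C * r ^ (CARD('n) - 1) \<le> r ^ CARD('n)
      \<Longrightarrow> \<exists>X :: (real ^ 'n) set. lattice_config UNIV r X \<and> covolume X = real u"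
    using lattice_config_exists[of "UNIV :: 'n set"] by auto
  have "\<exists>P \<in> (lattice_polytopes_between r :: (real ^ 'n) set set). normalized_volume P = real_of_int v"
    if r: "1 \<le> r" and v: "(real C + 1) * real r ^ (CARD('n) - 1) \<le> real_of_int v"
      "real_of_int v \<le> real r ^ CARD('n)" for r :: nat and v :: int
  proof -
    define u where "u = nat (int (r ^ CARD('n)) - v)"
    have "v \<le> int (r ^ CARD('n))" using v(2) by (metis of_int_le_iff of_int_of_nat_eq of_nat_power)
    then have u: "real u = real r ^ CARD('n) - real_of_int v" by (simp add: u_def)
    have r0: "0 \<le> real r ^ (CARD('n) - 1)" by simp
    have "real u + real C * real r ^ (CARD('n) - 1) \<le> real r ^ CARD('n)"
      using v(1) u r0 unfolding distrib_right mult_1 by linarith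
    then have "real (u + C * r ^ (CARD('n) - 1)) \<le> real (r ^ CARD('n))" by simp
    then have "u + C * r ^ (CARD('n) - 1) \<le> r ^ CARD('n)" by (simp only: of_nat_le_iff)
    then obtain X :: "(real ^ 'n) set" where X: "lattice_config UNIV r X" "covolume X = real u"
      using C[OF r] by blast
    let ?V = "X \<union> range (\<lambda>j. axis j (real r))"
    define P where "P = convex hull ?V"
    have P: "P = simplex_full r - under X"
      unfolding P_def by (rule convex_hull_lattice_config[OF X(1) r])
    have fin: "finite ?V" using X(1) by (simp add: lattice_config_def)
    have "{x. x extreme_point_of P} \<subseteq> ?V"
      unfolding P_def using extreme_point_of_convex_hull by blast
    also have "\<dots> \<subseteq> integer_lattice"
      using X(1) by (auto simp: lattice_config_def intro!: axis_in_integer_lattice)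
    finally have "{x. x extreme_point_of P} \<subseteq> integer_lattice" .
    moreover have "polytope P" unfolding polytope_def P_def using fin by blast
    ultimately have "lattice_polytope P" by (simp add: lattice_polytope_def)
    moreover have "simplex_face r \<subseteq> P"
    proof -
      have "real r *\<^sub>R axis i 1 = axis i (real r)" for i :: 'n
        by (simp add: vec_eq_iff axis_def)
      then show ?thesis unfolding simplex_face_def P_def by (intro hull_mono) auto
    qed
    ultimately have "P \<in> lattice_polytopes_between r"
      using P by (auto simp: lattice_polytopes_between_def)
    moreover have "normalized_volume P = real_of_int v"
    proof -
      have "under X \<in> lmeasurable"
        using X(1) by (intro lmeasurable_under) (auto simp: lattice_config_def)
      then have "measure lebesgue P
          = measure lebesgue (simplex_full r :: (real ^ 'n) set) - measure lebesgue (under X)"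
        unfolding P
        by (intro measurable_measure_Diff measure_simplex_full under_subset_simplex_full[OF X(1) r]) auto
      then have "normalized_volume P = real r ^ CARD('n) - covolume X"
        by (simp add: normalized_volume_def covolume_def measure_simplex_full right_diff_distrib)
      then show ?thesis using X(2) u by simp
    qed
    ultimately show ?thesis by blast
  qed
  then show ?thesis by (intro exI[of _ "real C + 1"]) auto
qed

end
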